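(* Let $\mathcal{O}$ be the class of all outerplanar graphs. Then (a) $3 \le \chi_{\mathrm{iCFo}}(\mathcal{O}) \le 4$; (b) $\chi_{\mathrm{iCFc}}(\mathcal{O}) = 3$; (c) $4 \le \chi_{\mathrm{iUMo}}(\mathcal{O}) \le 5$; (d) $3 \le \chi_{\mathrm{iUMc}}(\mathcal{O}) \le 5$.
   Context: $N(v)$ denotes the open neighborhood of a vertex $v$ and $N[v]=N(v)\cup\{v\}$ its closed neighborhood. Colorings with $k$ colors assign to vertices colors from $\{1,\dots,k\}$; they need not be proper here. An iCFo-coloring (resp. iCFc-coloring) of a graph $G$ (conflict-free coloring with respect to open, resp. closed, neighborhood) is a coloring of the vertices such that for every vertex $v$ there is at least one color appearing on exactly one vertex of $N(v)$ (resp. $N[v]$). An iUMo-coloring (resp. iUMc-coloring) of $G$ (unique-maximum coloring with respect to open, resp. closed, neighborhood) is a coloring of the vertices such that for every vertex $v$, the maximum color appearing on $N(v)$ (resp. $N[v]$) appears on exactly one vertex of $N(v)$ (resp. $N[v]$). $\chi_{\mathrm{iCFo}}(G)$, $\chi_{\mathrm{iCFc}}(G)$, $\chi_{\mathrm{iUMo}}(G)$, $\chi_{\mathrm{iUMc}}(G)$ denote the minimum $k$ such that $G$ has, respectively, an iCFo-, iCFc-, iUMo-, iUMc-coloring with $k$ colors. For an invariant $\chi_{.}$ and a graph class $\mathcal{C}$, $\chi_{.}(\mathcal{C}) = \max\{\chi_{.}(G) \mid G \in \mathcal{C}\}$. For the open neighborhood variants, only graphs without isolated vertices are considered (i.e.,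 in (a) and (c) the maximum is over graphs in the class having no isolated vertices). *)

theory Defs
  imports
    "HOL-Analysis.Analysis"
    "HOL-Library.Infinite_Typeclass"
    "Graph_Theory.Pair_Digraph"
begin

text \<open>
  Finite simple graphs are the symmetric loopless digraphs \<open>pair_graph\<close>: an edge between
  \<open>u\<close> and \<open>v\<close> is the pair of opposite arcs \<open>(u, v)\<close> and \<open>(v, u)\<close>.
\<close>

definition open_nbhd :: "'a pair_pre_digraph \<Rightarrow> 'a \<Rightarrow> 'a set" where
  "open_nbhd G v = {u. (v, u) \<in> parcs G}"

definition closed_nbhd :: "'a pair_pre_digraph \<Rightarrow> 'a \<Rightarrow> 'a set" where
  "closed_nbhd G v = insert v (open_nbhd G v)"

definition no_isolated_vertices :: "'a pair_pre_digraph \<Rightarrow> bool" where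
  "no_isolated_vertices G \<longleftrightarrow> (\<forall>v\<in>pverts G. open_nbhd G v \<noteq> {})"


subsection \<open>Outerplanar graphs\<close>

text \<open>
  A crossing-free drawing in the plane: distinct points for the vertices, and for every edge a
  simple arc between its end points.  Both arcs \<open>(u, v)\<close> and \<open>(v, u)\<close> of the digraph are drawn
  as the same point set, traversed in opposite directions.
\<close>

definition plane_drawing ::
  "'a pair_pre_digraph \<Rightarrow> ('a \<Rightarrow> complex) \<Rightarrow> ('a \<times> 'a \<Rightarrow> real \<Rightarrow> complex) \<Rightarrow> bool" where
  "plane_drawing G pos \<gamma> \<longleftrightarrow>
     inj_on pos (pverts G) \<and>
     (\<forall>(u, v)\<in>parcs G.
        arc (\<gamma> (u, v)) \<and> pathstart (\<gamma> (u, v)) = pos u \<and> pathfinish (\<gamma> (u, v)) = pos v \<and>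
        \<gamma> (v, u) = reversepath (\<gamma> (u, v)) \<and>
        path_image (\<gamma> (u, v)) \<inter> pos ` pverts G = {pos u, pos v}) \<and>
     (\<forall>(u, v)\<in>parcs G. \<forall>(x, y)\<in>parcs G. {u, v} \<noteq> {x, y} \<longrightarrow>
        path_image (\<gamma> (u, v)) \<inter> path_image (\<gamma> (x, y)) \<subseteq> pos ` ({u, v} \<inter> {x, y}))"

definition drawing_points ::
  "'a pair_pre_digraph \<Rightarrow> ('a \<Rightarrow> complex) \<Rightarrow> ('a \<times> 'a \<Rightarrow> real \<Rightarrow> complex) \<Rightarrow> complex set" where
  "drawing_points G pos \<gamma> = pos ` pverts G \<union> (\<Union>e\<in>parcs G. path_image (\<gamma> e))"

text \<open>
  The outer face of a drawing is the unbounded component of its complement, which is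
  \<^const>\<open>outside\<close> of the drawing, as the drawing is a bounded subset of the plane.
\<close>

definition outerplanar :: "'a pair_pre_digraph \<Rightarrow> bool" where
  "outerplanar G \<longleftrightarrow>
     (\<exists>pos \<gamma>. plane_drawing G pos \<gamma> \<and>
        (\<forall>v\<in>pverts G. pos v \<in> frontier (outside (drawing_points G pos \<gamma>))))"

definition outerplanar_graphs :: "'a pair_pre_digraph set" where
  "outerplanar_graphs = {G. pair_graph G \<and> outerplanar G}"


subsection \<open>Conflict-free and unique-maximum colorings\<close>

definition has_unique_color :: "('a \<Rightarrow> nat) \<Rightarrow> 'a set \<Rightarrow> bool" where
  "has_unique_color c N \<longleftrightarrow> (\<exists>i. card {u \<in> N. c u = i} = 1)"

text \<open>For \<open>N = {}\<close> the predicate is false, whatever value \<^term>\<open>Max {}\<close> has.\<close>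

definition has_unique_max :: "('a \<Rightarrow> nat) \<Rightarrow> 'a set \<Rightarrow> bool" where
  "has_unique_max c N \<longleftrightarrow> card {u \<in> N. c u = Max (c ` N)} = 1"

definition coloring_with :: "'a pair_pre_digraph \<Rightarrow> nat \<Rightarrow> ('a \<Rightarrow> nat) \<Rightarrow> bool" where
  "coloring_with G k c \<longleftrightarrow> c ` pverts G \<subseteq> {1..k}"

definition iCFo_coloring :: "'a pair_pre_digraph \<Rightarrow> nat \<Rightarrow> ('a \<Rightarrow> nat) \<Rightarrow> bool" where
  "iCFo_coloring G k c \<longleftrightarrow>
     coloring_with G k c \<and> (\<forall>v\<in>pverts G. has_unique_color c (open_nbhd G v))"

definition iCFc_coloring :: "'a pair_pre_digraph \<Rightarrow> nat \<Rightarrow> ('a \<Rightarrow> nat) \<Rightarrow> bool" where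
  "iCFc_coloring G k c \<longleftrightarrow>
     coloring_with G k c \<and> (\<forall>v\<in>pverts G. has_unique_color c (closed_nbhd G v))"

definition iUMo_coloring :: "'a pair_pre_digraph \<Rightarrow> nat \<Rightarrow> ('a \<Rightarrow> nat) \<Rightarrow> bool" where
  "iUMo_coloring G k c \<longleftrightarrow>
     coloring_with G k c \<and> (\<forall>v\<in>pverts G. has_unique_max c (open_nbhd G v))"

definition iUMc_coloring :: "'a pair_pre_digraph \<Rightarrow> nat \<Rightarrow> ('a \<Rightarrow> nat) \<Rightarrow> bool" where
  "iUMc_coloring G k c \<longleftrightarrow>
     coloring_with G k c \<and> (\<forall>v\<in>pverts G. has_unique_max c (closed_nbhd G v))"

definition chi_iCFo :: "'a pair_pre_digraph \<Rightarrow> nat" where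
  "chi_iCFo G = (LEAST k. \<exists>c. iCFo_coloring G k c)"

definition chi_iCFc :: "'a pair_pre_digraph \<Rightarrow> nat" where
  "chi_iCFc G = (LEAST k. \<exists>c. iCFc_coloring G k c)"

definition chi_iUMo :: "'a pair_pre_digraph \<Rightarrow> nat" where
  "chi_iUMo G = (LEAST k. \<exists>c. iUMo_coloring G k c)"

definition chi_iUMc :: "'a pair_pre_digraph \<Rightarrow> nat" where
  "chi_iUMc G = (LEAST k. \<exists>c. iUMc_coloring G k c)"


subsection \<open>Invariants of graph classes\<close>

text \<open>
  \<^const>\<open>Max\<close> is only meaningful for finite nonempty sets; \<open>class_max_exists\<close> records that the
  maximum exists.
\<close>

definition class_max :: "('a pair_pre_digraph \<Rightarrow> nat) \<Rightarrow> 'a pair_pre_digraph set \<Rightarrow> nat" where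
  "class_max f \<C> = Max {f G | G. G \<in> \<C>}"

definition class_max_exists ::
  "('a pair_pre_digraph \<Rightarrow> nat) \<Rightarrow> 'a pair_pre_digraph set \<Rightarrow> bool" where
  "class_max_exists f \<C> \<longleftrightarrow> finite {f G | G. G \<in> \<C>} \<and> {f G | G. G \<in> \<C>} \<noteq> {}"


subsection \<open>Every minimum above is taken over a nonempty set\<close>

lemma open_nbhd_subset:
  assumes "pair_graph G"
  shows "open_nbhd G v \<subseteq> pverts G"
proof -
  interpret pair_graph G by fact
  show ?thesis
    using arc_snd_in_verts by (fastforce simp: open_nbhd_def)
qed

lemma inj_on_unique:
  assumes "inj_on c N" "finite N" "N \<noteq> {}"
  shows "has_unique_color c N" "has_unique_max c N"
proof -
  have one: "card {u \<in> N. c u = c x} = 1" if "x \<in> N" for x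
  proof -
    have "{u \<in> N. c u = c x} = {x}"
      using assms(1) that by (auto dest: inj_onD)
    then show ?thesis by simp
  qed
  obtain x where "x \<in> N" using assms(3) by auto
  from one[OF this] show "has_unique_color c N"
    unfolding has_unique_color_def by (rule exI)
  have "Max (c ` N) \<in> c ` N"
    using assms by (intro Max_in) auto
  then obtain y where "y \<in> N" "Max (c ` N) = c y" by auto
  with one[of y] show "has_unique_max c N"
    by (simp add: has_unique_max_def)
qed

lemma colorings_exist:
  fixes G :: "'a pair_pre_digraph"
  assumes G: "pair_graph G"
  shows "\<exists>k c. iCFc_coloring G k c" "\<exists>k c. iUMc_coloring G k c"
    "no_isolated_vertices G \<Longrightarrow> \<exists>k c. iCFo_coloring G k c"
    "no_isolated_vertices G \<Longrightarrow> \<exists>k c. iUMo_coloring G k c"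
proof -
  interpret pair_graph G by fact
  have fin: "finite (pverts G)"
    by (rule pair_finite_verts)
  obtain h where h: "bij_betw h {1..card (pverts G)} (pverts G)"
    using ex_bij_betw_nat_finite_1[OF fin] by (elim exE)
  define c where "c = inv_into {1..card (pverts G)} h"
  have c: "bij_betw c (pverts G) {1..card (pverts G)}"
    unfolding c_def by (rule bij_betw_inv_into[OF h])
  have sub: "has_unique_color c N" "has_unique_max c N" if "N \<subseteq> pverts G" "N \<noteq> {}" for N
    using inj_on_unique[of c N] that inj_on_subset[OF bij_betw_imp_inj_on[OF c]]
      finite_subset[OF _ fin] by metis+
  have k: "coloring_with G (card (pverts G)) c"
    using c by (simp add: coloring_with_def bij_betw_def)
  have cl: "closed_nbhd G v \<subseteq> pverts G" "closed_nbhd G v \<noteq> {}" if "v \<in> pverts G" for v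
    using that open_nbhd_subset[OF G, of v] by (auto simp: closed_nbhd_def)
  show "\<exists>k c. iCFc_coloring G k c" "\<exists>k c. iUMc_coloring G k c"
    unfolding iCFc_coloring_def iUMc_coloring_def using k sub[OF cl] by metis+
  assume "no_isolated_vertices G"
  then have ne: "open_nbhd G v \<noteq> {}" if "v \<in> pverts G" for v
    using that by (simp add: no_isolated_vertices_def)
  show "\<exists>k c. iCFo_coloring G k c" "\<exists>k c. iUMo_coloring G k c"
    unfolding iCFo_coloring_def iUMo_coloring_def
    using k sub[OF open_nbhd_subset[OF G] ne] by metis+
qed

end

theory Submission
  imports Defs
begin

text \<open>
  The only property of outerplanar graphs that is used is the absence of a \<open>K\<^sub>2\<^sub>,\<^sub>3\<close> minor: three
  disjoint arcs joining two points form a theta curve, and one of the arcs runs inside the loop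
  formed by the other two, so a vertex on it cannot lie on the outer face.

  For the upper bounds take a maximal set \<open>D\<close> of vertices with pairwise disjoint closed
  neighborhoods whose union \<open>T\<close> is connected within every component. Every vertex outside \<open>T\<close> then
  has a neighbor in \<open>T\<close>, so contracting \<open>T\<close> shows that the graph induced outside \<open>T\<close> has maximum
  degree 2 and no cycle longer than a triangle. The set \<open>D\<close> receives the top color, which serves
  all neighbors of \<open>D\<close>. For closed neighborhoods, one more color on an efficient dominating set of
  the vertices outside \<open>T\<close> suffices. For open neighborhoods, the remaining vertices of \<open>T\<close> are
  colored with three colors so that \<open>D\<close> and the vertices outside \<open>T\<close> see a unique maximum there; this
  is done greedily along a layering of the bipartite graph between both sides, in which each new
  vertex has at most two forbidden colors. The vertices outside \<open>T\<close> come last, again with at most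
  two forbidden colors each.
\<close>

section \<open>Excluded minors of outerplanar graphs\<close>

text \<open>The count behind the open coloring: if a set has a strict maximum, a new member of any
  color other than that maximum preserves this, the winner being the old one or the new member. So a
  vertex colored last has one forbidden color per neighborhood it joins, and three colors tolerate
  two. The degree bounds come from \<open>K\<^sub>2\<^sub>,\<^sub>3\<close> minors in which a large
  connected set, the cover or the part explored so far, is one of the branch sets; this is why
  connectivity is built into the packing and into the exploration. The open case is harder because a
  vertex of \<open>D\<close> has no neighbor in \<open>D\<close>: the top color serves neither
  \<open>D\<close> nor the vertices outside the cover. Both are served by lower colors on the
  noncentral cover vertices, before the outside is colored. The unique-maximum colorings use 3
  colors for closed and 4 for open neighborhoods. They are conflict-free as well, so they give all
  four upper bounds, and the value 5 in (c) and (d) is a weakening. The lower bounds come from three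
  explicit graphs, drawn with straight chords between points of a parabola.\<close>

lemma theta_loop:
  fixes g h :: "real \<Rightarrow> complex"
  assumes "arc g" "arc h" "pathstart g = a" "pathfinish g = b" "pathstart h = a" "pathfinish h = b"
    "path_image g \<inter> path_image h = {a, b}"
  defines "C \<equiv> path_image g \<union> path_image h"
  shows "inside C \<noteq> {}" "open (inside C)" "connected (inside C)" "connected (outside C)"
    "frontier (inside C) = C" "inside C \<inter> outside C = {}" "inside C \<union> outside C = - C"
    "compact C"
proof -
  let ?l = "g +++ reversepath h"
  have img: "path_image ?l = C"
    using assms by (simp add: path_image_join C_def)
  have "simple_path ?l"
    using assms by (intro simple_path_join_loop arc_reversepath) auto
  moreover have "pathfinish ?l = pathstart ?l"
    using assms by simp
  ultimately have J: "inside C \<noteq> {} \<and> open (inside C) \<and> connected (inside C) \<and> connected (outside C) \<and>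
    frontier (inside C) = C \<and> inside C \<inter> outside C = {} \<and> inside C \<union> outside C = - C"
    using Jordan_inside_outside[of ?l] unfolding img by blast
  then show "inside C \<noteq> {}" "open (inside C)" "connected (inside C)" "connected (outside C)"
    "frontier (inside C) = C" "inside C \<inter> outside C = {}" "inside C \<union> outside C = - C"
    by auto
  show "compact C"
    using assms(1,2) by (auto simp: C_def intro!: compact_arc_image)
qed

lemma connected_open_arc:
  assumes "arc (g :: real \<Rightarrow> complex)"
  shows "connected (path_image g - {pathstart g, pathfinish g})"
  using connected_simple_path_endless[OF arc_imp_simple_path[OF assms]] .

text \<open>Let \<open>A\<close> and \<open>B\<close> be the insides of the two loops. The open
  third arc misses the frontier of \<open>A\<close>, so it misses \<open>A\<close> or lies in it,
  and the latter is excluded by \<open>out3\<close>. Then the connected set \<open>A\<close> misses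
  the frontier of \<open>B\<close>; contained in \<open>B\<close> it would drag the second arc
  along, against \<open>out2\<close>.\<close>

lemma arc_third_inside:
  fixes g1 g2 g3 :: "real \<Rightarrow> complex"
  assumes arcs: "arc g1" "arc g2" "arc g3"
    and ends: "pathstart g1 = a" "pathfinish g1 = b" "pathstart g2 = a" "pathfinish g2 = b"
      "pathstart g3 = a" "pathfinish g3 = b"
    and int: "path_image g1 \<inter> path_image g2 = {a, b}" "path_image g1 \<inter> path_image g3 = {a, b}"
      "path_image g2 \<inter> path_image g3 = {a, b}"
    and out3: "\<not> path_image g3 - {a, b} \<subseteq> inside (path_image g1 \<union> path_image g2)"
    and out2: "\<not> path_image g2 - {a, b} \<subseteq> inside (path_image g1 \<union> path_image g3)"
  shows "inside (path_image g1 \<union> path_image g2) \<subseteq> outside (path_image g1 \<union> path_image g3)"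
proof -
  let ?G1 = "path_image g1" and ?G2 = "path_image g2" and ?G3 = "path_image g3"
  define A where "A = inside (?G1 \<union> ?G2)"
  define B where "B = inside (?G1 \<union> ?G3)"
  note tA = theta_loop[OF arcs(1,2) ends(1-4) int(1), folded A_def]
  note tB = theta_loop[OF arcs(1,3) ends(1,2,5,6) int(2), folded B_def]
  have disj: "(?G3 - {a, b}) \<inter> A = {}"
  proof (rule ccontr)
    assume n: "(?G3 - {a, b}) \<inter> A \<noteq> {}"
    have "(?G3 - {a, b}) - A \<noteq> {}" using out3 by (auto simp: A_def)
    moreover have "connected (?G3 - {a, b})"
      using connected_open_arc[OF arcs(3)] ends by simp
    ultimately have "(?G3 - {a, b}) \<inter> frontier A \<noteq> {}"
      using n by (intro connected_Int_frontier)
    then show False using tA(5) int by auto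
  qed
  have AC: "A \<inter> (?G1 \<union> ?G2) = {}" using tA(7) by auto
  have ab: "{a, b} \<subseteq> ?G1" using int by auto
  have A3: "A \<inter> (?G1 \<union> ?G3) = {}" using disj AC ab by auto
  have "A \<inter> B = {}"
  proof (rule ccontr)
    assume n: "A \<inter> B \<noteq> {}"
    have "A \<subseteq> B"
      using connected_Int_frontier[OF tA(3) n] tB(5) A3 by auto
    then have "closure A \<subseteq> closure B" by (rule closure_mono)
    moreover have "?G2 \<subseteq> closure A" 
      using tA(5) by (auto simp: frontier_def)
    moreover have "closure B \<subseteq> B \<union> (?G1 \<union> ?G3)"
      using tB(5) closure_Un_frontier[of B] by auto
    ultimately have "?G2 - {a, b} \<subseteq> B" using int by blast
    then show False using out2 by (simp add: B_def)
  qed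
  then have "A \<subseteq> outside (?G1 \<union> ?G3)" using A3 tB(7) B_def by blast
  then show ?thesis by (simp add: A_def)
qed

text \<open>
  If each arc avoided the inside of the loop formed by the other two, a point inside one loop would
  be separated from infinity neither by the second nor by the third loop, hence by Janiszewski not
  by their union either.
\<close>
lemma theta_arc_inside:
  fixes g1 g2 g3 :: "real \<Rightarrow> complex"
  assumes arcs: "arc g1" "arc g2" "arc g3"
    and ends: "pathstart g1 = a" "pathfinish g1 = b" "pathstart g2 = a" "pathfinish g2 = b"
      "pathstart g3 = a" "pathfinish g3 = b"
    and int: "path_image g1 \<inter> path_image g2 = {a, b}" "path_image g1 \<inter> path_image g3 = {a, b}"
      "path_image g2 \<inter> path_image g3 = {a, b}"
  shows "path_image g1 - {a, b} \<subseteq> inside (path_image g2 \<union> path_image g3) \<or>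
    path_image g2 - {a, b} \<subseteq> inside (path_image g1 \<union> path_image g3) \<or>
    path_image g3 - {a, b} \<subseteq> inside (path_image g1 \<union> path_image g2)"
proof (rule ccontr)
  assume n: "\<not> ?thesis"
  let ?G1 = "path_image g1" and ?G2 = "path_image g2" and ?G3 = "path_image g3"
  note t12 = theta_loop[OF arcs(1,2) ends(1-4) int(1)]
  note t13 = theta_loop[OF arcs(1,3) ends(1,2,5,6) int(2)]
  note t23 = theta_loop[OF arcs(2,3) ends(3-6) int(3)]
  obtain x where x: "x \<in> inside (?G1 \<union> ?G2)" using t12(1) by auto
  have "bounded ((?G1 \<union> ?G3) \<union> (?G2 \<union> ?G3))"
    using compact_imp_bounded[OF t13(8)] compact_imp_bounded[OF t23(8)] by auto
  then have "outside ((?G1 \<union> ?G3) \<union> (?G2 \<union> ?G3)) \<noteq> {}"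
    by (rule outside_bounded_nonempty)
  then obtain y where y: "y \<in> outside ((?G1 \<union> ?G3) \<union> (?G2 \<union> ?G3))" by auto
  have y': "y \<in> outside (?G1 \<union> ?G3)" "y \<in> outside (?G2 \<union> ?G3)" "y \<in> outside (?G1 \<union> ?G2)"
    using y by (meson outside_mono subsetD sup_ge1 sup_ge2 le_sup_iff Un_subset_iff)+
  have x1: "x \<in> outside (?G1 \<union> ?G3)"
    using arc_third_inside[OF arcs ends int] n x by auto
  have x2: "x \<in> outside (?G2 \<union> ?G3)"
    using arc_third_inside[of g2 g1 g3 a b] arcs ends int n x by (auto simp: Un_commute Int_commute)
  have conn: "connected_component (- C) x y" if "x \<in> outside C" "y \<in> outside C" "connected (outside C)" for C
    unfolding connected_component_def
    using that by (intro exI[of _ "outside C"]) (auto simp: outside_def)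
  \<comment> \<open>Janiszewski asks for a connected overlap of the two loops; here it is exactly
    the third arc, as the other two meet only in its ends.\<close>
  have "(?G1 \<union> ?G3) \<inter> (?G2 \<union> ?G3) = ?G3" using int by auto
  then have "connected ((?G1 \<union> ?G3) \<inter> (?G2 \<union> ?G3))"
    using arcs(3) by (simp add: connected_arc_image)
  then have "connected_component (- ((?G1 \<union> ?G3) \<union> (?G2 \<union> ?G3))) x y"
    using Janiszewski[OF t13(8) compact_imp_closed[OF t23(8)]] conn[OF x1 y'(1) t13(4)] conn[OF x2 y'(2) t23(4)]
    by blast
  then have "connected_component (- (?G1 \<union> ?G2)) x y"
    by (rule connected_component_of_subset) auto
  then have "y \<in> inside (?G1 \<union> ?G2)" using x by (rule inside_same_component)
  then show False using y'(3) t12(6) by blast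
qed

section \<open>Tripods in path-connected plane sets\<close>

lemma first_hit:
  fixes K :: "complex set"
  assumes "path_connected K" "c \<in> K" "closed F" "F \<inter> K \<noteq> {}"
  obtains a T where "a \<in> F" "T \<subseteq> K" "a \<in> T" "c \<in> T" "closed T" "path_connected T" "T \<inter> F = {a}"
proof (cases "c \<in> F")
  case True
  then show ?thesis using assms(2) by (intro that[of c "{c}"]) auto
next
  case False
  obtain z where z: "z \<in> F" "z \<in> K" using assms(4) by auto
  obtain h where h: "path h" "path_image h \<subseteq> K" "pathstart h = c" "pathfinish h = z"
    using assms(1,2) z unfolding path_connected_def by meson
  have "pathstart h \<in> closure (- F)" using False h closure_subset[of "- F"] by auto
  \<comment> \<open>\<open>k\<close> is the initial piece of \<open>h\<close> up to its first point
    in \<open>F\<close>; before that it stays in the open set \<open>- F\<close>.\<close>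
  then obtain k where k: "path k" "pathstart k = pathstart h" "path_image k \<subseteq> path_image h"
      "path_image k - {pathfinish k} \<subseteq> interior (- F)" "pathfinish k \<in> frontier (- F)"
    using exists_path_subpath_to_frontier[OF h(1), of "- F"] h z by (metis ComplD)
  have "pathfinish k \<in> F"
    using k(5) assms(3) by (metis frontier_complement frontier_subset_closed subsetD)
  then show ?thesis
    using k h interior_subset[of "- F"]
    by (intro that[of "pathfinish k" "path_image k"])
      (auto simp: closed_path_image path_connected_path_image)
qed

lemma split_arc:
  fixes g :: "real \<Rightarrow> complex"
  assumes "arc g" "p \<in> path_image g"
  obtains T1 T2 where "T1 \<union> T2 = path_image g" "T1 \<inter> T2 = {p}" "pathstart g \<in> T1" "pathfinish g \<in> T2"
    "closed T1" "closed T2" "path_connected T1" "path_connected T2"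
proof -
  obtain t where t: "t \<in> {0..1}" "p = g t" using assms(2) by (auto simp: path_image_def)
  have cont: "continuous_on {0..1} g" and inj: "inj_on g {0..1}" 
    using assms(1) by (auto simp: arc_def path_def)
  have *: "compact (g ` {u..v})" "path_connected (g ` {u..v})" if "{u..v} \<subseteq> {0..1}" for u v
    using continuous_on_subset[OF cont that] 
    by (auto intro!: compact_continuous_image path_connected_continuous_image)
  have "g ` {0..t} \<inter> g ` {t..1} = g ` ({0..t} \<inter> {t..1})"
    using t by (intro inj_on_image_Int[OF inj, symmetric]) auto
  also have "{0..t} \<inter> {t..1} = {t}" using t by auto
  finally show ?thesis
    using t * by (intro that[of "g ` {0..t}" "g ` {t..1}"])
      (auto simp: path_image_def pathstart_def pathfinish_def compact_imp_closed simp flip: image_Un)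
qed

text \<open>Join \<open>a1\<close> to \<open>a2\<close> by an arc and walk from \<open>a3\<close>
  until that arc is first hit; the point of contact is the center \<open>a\<close>. Legs are closed
  sets rather than arcs because they may shrink to a point, as happens when the feet
  coincide.\<close>

lemma tripod:
  fixes K :: "complex set"
  assumes K: "path_connected K" "a1 \<in> K" "a2 \<in> K" "a3 \<in> K"
  obtains a T1 T2 T3 where "T1 \<subseteq> K" "T2 \<subseteq> K" "T3 \<subseteq> K" "{a, a1} \<subseteq> T1" "{a, a2} \<subseteq> T2" "{a, a3} \<subseteq> T3"
    "closed T1" "closed T2" "closed T3" "path_connected T1" "path_connected T2" "path_connected T3"
    "T1 \<inter> T2 = {a}" "T1 \<inter> T3 = {a}" "T2 \<inter> T3 = {a}"
proof (cases "a1 = a2")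
  case True
  obtain h where h: "path h" "path_image h \<subseteq> K" "pathstart h = a1" "pathfinish h = a3"
    using K unfolding path_connected_def by meson
  show ?thesis
    using True h K pathstart_in_path_image[of h] pathfinish_in_path_image[of h]
    by (intro that[of "{a1}" "{a1}" "path_image h" a1])
      (auto simp: closed_path_image path_connected_path_image)
next
  case False
  obtain g where g: "arc g" "path_image g \<subseteq> K" "pathstart g = a1" "pathfinish g = a2"
    using K False by (metis path_connected_arcwise)
  have "a1 \<in> path_image g" using g by auto
  then obtain a T where a: "a \<in> path_image g" "T \<subseteq> K" "a \<in> T" "a3 \<in> T" "closed T" "path_connected T"
      "T \<inter> path_image g = {a}"
    using first_hit[OF K(1,4) closed_arc_image[OF g(1)]] K(2) by blast
  obtain T1 T2 where "T1 \<union> T2 = path_image g" "T1 \<inter> T2 = {a}" "pathstart g \<in> T1" "pathfinish g \<in> T2"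
    "closed T1" "closed T2" "path_connected T1" "path_connected T2"
    using split_arc[OF g(1) a(1)] .
  then show ?thesis
    using a g by (intro that[of T1 T2 T a]) auto
qed

definition linked :: "('a \<times> 'a) set \<Rightarrow> 'a set \<Rightarrow> 'a set \<Rightarrow> bool" where
  "linked E S T \<longleftrightarrow> (\<exists>x\<in>S. \<exists>y\<in>T. (x, y) \<in> E)"

definition connected_in :: "('a \<times> 'a) set \<Rightarrow> 'a set \<Rightarrow> bool" where
  "connected_in E S \<longleftrightarrow> S \<noteq> {} \<and> (\<forall>x\<in>S. \<forall>y\<in>S. (x, y) \<in> (Restr E S)\<^sup>*)"

text \<open>\<open>A\<close> and \<open>B\<close> are the branch sets of the two vertices of degree
  three, called hubs below; \<open>C1\<close>, \<open>C2\<close>, \<open>C3\<close> are the middle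
  sets. The property belongs to an arc relation, so that it passes to the bipartite subrelation
  between clients and servers.\<close>

definition K23_minor_free :: "('a \<times> 'a) set \<Rightarrow> bool" where
  "K23_minor_free E \<longleftrightarrow> (\<forall>A B C1 C2 C3.
     connected_in E A \<and> connected_in E B \<and>
     connected_in E C1 \<and> connected_in E C2 \<and> connected_in E C3 \<and>
     A \<inter> B = {} \<and> (A \<union> B) \<inter> (C1 \<union> C2 \<union> C3) = {} \<and>
     C1 \<inter> C2 = {} \<and> C1 \<inter> C3 = {} \<and> C2 \<inter> C3 = {} \<longrightarrow>
     \<not> (\<forall>C\<in>{C1, C2, C3}. linked E A C \<and> linked E C B))"

section \<open>From a minor in a plane drawing to a theta curve\<close>

locale drawn_graph =
  fixes G :: "'a pair_pre_digraph" and pos :: "'a \<Rightarrow> complex" and \<gamma> :: "'a \<times> 'a \<Rightarrow> real \<Rightarrow> complex"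
  assumes graph: "pair_graph G" and drawing: "plane_drawing G pos \<gamma>"
begin

abbreviation seg :: "'a \<Rightarrow> 'a \<Rightarrow> complex set" where
  "seg u v \<equiv> path_image (\<gamma> (u, v))"

text \<open>The drawing of the subgraph induced on \<open>S\<close>: it turns a branch set into a
  plane set in which tripods and arcs can be found.\<close>

definition net :: "'a set \<Rightarrow> complex set" where
  "net S = pos ` S \<union> (\<Union>e\<in>Restr (parcs G) S. path_image (\<gamma> e))"

lemma arc_verts:
  assumes "(u, v) \<in> parcs G"
  shows "u \<in> pverts G" "v \<in> pverts G"
proof -
  interpret pair_graph G by (rule graph)
  show "u \<in> pverts G" "v \<in> pverts G"
    using arc_fst_in_verts[OF assms] arc_snd_in_verts[OF assms] by auto
qed

lemma pos_inj: "inj_on pos (pverts G)"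
  using drawing by (simp add: plane_drawing_def)

lemma seg:
  assumes "(u, v) \<in> parcs G"
  shows "arc (\<gamma> (u, v))" "pos u \<in> seg u v" "pos v \<in> seg u v"
    "seg u v \<inter> pos ` pverts G = {pos u, pos v}" "closed (seg u v)" "path_connected (seg u v)"
proof -
  have *: "arc (\<gamma> (u, v)) \<and> pathstart (\<gamma> (u, v)) = pos u \<and> pathfinish (\<gamma> (u, v)) = pos v \<and>
      seg u v \<inter> pos ` pverts G = {pos u, pos v}"
    using drawing unfolding plane_drawing_def by (elim conjE) (drule bspec[OF _ assms], simp)
  then show a: "arc (\<gamma> (u, v))" and "seg u v \<inter> pos ` pverts G = {pos u, pos v}"
    by simp_all
  then show "pos u \<in> seg u v" "pos v \<in> seg u v" by blast+
  show "closed (seg u v)" "path_connected (seg u v)"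
    using a by (auto simp: closed_arc_image arc_imp_path path_connected_path_image)
qed

lemma seg_inter:
  assumes "(u, v) \<in> parcs G" "(x, y) \<in> parcs G" "{u, v} \<noteq> {x, y}"
  shows "seg u v \<inter> seg x y \<subseteq> pos ` ({u, v} \<inter> {x, y})"
proof -
  have "\<forall>(u, v)\<in>parcs G. \<forall>(x, y)\<in>parcs G. {u, v} \<noteq> {x, y} \<longrightarrow> seg u v \<inter> seg x y \<subseteq> pos ` ({u, v} \<inter> {x, y})"
    using drawing unfolding plane_drawing_def by (elim conjE)
  from bspec[OF bspec[OF this assms(1), simplified] assms(2)] show ?thesis using assms(3) by simp
qed

lemma seg_net:
  assumes "(u, v) \<in> parcs G" "S \<subseteq> pverts G" "\<not> {u, v} \<subseteq> S"
  shows "seg u v \<inter> net S \<subseteq> pos ` ({u, v} \<inter> S)"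
proof -
  have "seg u v \<inter> pos ` S \<subseteq> pos ` ({u, v} \<inter> S)"
  proof
    fix z assume z: "z \<in> seg u v \<inter> pos ` S"
    then obtain s where s: "s \<in> S" "z = pos s" by auto
    have "z \<in> {pos u, pos v}" using z seg(4)[OF assms(1)] assms(2) by blast
    then have "s = u \<or> s = v"
      using s pos_inj assms(2) arc_verts[OF assms(1)] by (auto dest: inj_onD)
    then show "z \<in> pos ` ({u, v} \<inter> S)" using s by auto
  qed
  moreover have "seg u v \<inter> path_image (\<gamma> e) \<subseteq> pos ` ({u, v} \<inter> S)" if e: "e \<in> Restr (parcs G) S" for e
  proof -
    obtain x y where e: "e = (x, y)" "(x, y) \<in> parcs G" "x \<in> S" "y \<in> S" using e by (cases e) auto
    then have "{u, v} \<noteq> {x, y}" using assms(3) by auto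
    from seg_inter[OF assms(1) e(2) this] show ?thesis using e by auto
  qed
  ultimately show ?thesis unfolding net_def by blast
qed

lemma net_disjoint:
  assumes "S \<subseteq> pverts G" "T \<subseteq> pverts G" "S \<inter> T = {}"
  shows "net S \<inter> net T = {}"
proof -
  have "pos ` S \<inter> pos ` T = {}"
    using inj_on_image_Int[OF pos_inj assms(1,2)] assms(3) by auto
  moreover have "path_image (\<gamma> e) \<inter> net T = {}" if "e \<in> Restr (parcs G) S" for e
    using that seg_net[of "fst e" "snd e" T] assms by (cases e) auto
  moreover have "path_image (\<gamma> e) \<inter> net S = {}" if "e \<in> Restr (parcs G) T" for e
    using that seg_net[of "fst e" "snd e" S] assms by (cases e) auto
  ultimately show ?thesis unfolding net_def by blast
qed

lemma net_closed:
  assumes "S \<subseteq> pverts G"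
  shows "closed (net S)"
proof -
  interpret pair_graph G by (rule graph)
  have "finite S" "finite (Restr (parcs G) S)"
    using assms finite_subset[OF _ pair_finite_verts] finite_subset[OF _ pair_finite_arcs] by auto
  moreover from this have "closed (\<Union>e\<in>Restr (parcs G) S. path_image (\<gamma> e))"
    using seg(5) by (intro closed_UN) auto
  ultimately show ?thesis
    unfolding net_def by (intro closed_Un finite_imp_closed[OF finite_imageI])
qed

lemma net_path_connected:
  assumes "connected_in (parcs G) S"
  shows "path_connected (net S)"
proof -
  have edge: "path_component (net S) (pos x) z" if "(x, y) \<in> Restr (parcs G) S" "z \<in> seg x y" for x y z
  proof -
    have "seg x y \<subseteq> net S" using that by (auto simp: net_def)
    moreover have "path_component (seg x y) (pos x) z"
      using seg[of x y] that by (auto simp: path_connected_component)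
    ultimately show ?thesis by (rule path_component_of_subset)
  qed
  have verts: "path_component (net S) (pos x) (pos y)" if "(x, y) \<in> (Restr (parcs G) S)\<^sup>*" "x \<in> S" for x y
    using that
  proof (induction rule: rtrancl_induct)
    case base
    then show ?case by (auto simp: net_def intro!: path_component_refl)
  next
    case (step y z)
    have "path_component (net S) (pos y) (pos z)"
      using edge[OF step(2)] seg(3)[of y z] step(2) by auto
    then show ?case using step path_component_trans by blast
  qed
  obtain r where r: "r \<in> S" using assms by (auto simp: connected_in_def)
  have "path_component (net S) (pos r) z" if z: "z \<in> net S" for z
  proof -
    obtain x where x: "x \<in> S" "path_component (net S) (pos x) z"
    proof (cases "z \<in> pos ` S")
      case True
      then obtain x where "x \<in> S" "z = pos x" by auto
      then show ?thesis using z by (intro that[of x]) (auto intro: path_component_refl)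
    next
      case False
      then obtain x y where "(x, y) \<in> Restr (parcs G) S" "z \<in> seg x y" 
        using z by (auto simp: net_def)
      then show ?thesis using edge by (intro that[of x]) auto
    qed
    have "path_component (net S) (pos r) (pos x)"
      using assms r x by (intro verts) (auto simp: connected_in_def)
    then show ?thesis using x path_component_trans by blast
  qed
  then show ?thesis
    unfolding path_connected_component using path_component_sym path_component_trans by blast
qed

text \<open>A strand runs from hub to hub: a tripod leg in \<open>net A\<close>, an edge, the net of
  a middle set, an edge, a tripod leg in \<open>net B\<close>. Two strands may leave
  \<open>A\<close> at the same vertex; both legs then contain its point, which must therefore be
  \<open>a\<close>, and similarly at \<open>B\<close>. The other pieces are kept apart by the
  disjointness of the branch sets and by the plane drawing.\<close>

lemma strands_meet:
  assumes "A \<subseteq> pverts G" "B \<subseteq> pverts G" "C \<subseteq> pverts G" "C' \<subseteq> pverts G"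
    and disj: "A \<inter> B = {}" "(A \<union> B) \<inter> (C \<union> C') = {}" "C \<inter> C' = {}"
    and T: "T \<subseteq> net A" "T' \<subseteq> net A" "T \<inter> T' = {a}" "pos p \<in> T" "pos p' \<in> T'"
    and U: "U \<subseteq> net B" "U' \<subseteq> net B" "U \<inter> U' = {b}" "pos q \<in> U" "pos q' \<in> U'"
    and e: "(p, c) \<in> parcs G" "(d, q) \<in> parcs G" "p \<in> A" "c \<in> C" "d \<in> C" "q \<in> B"
    and e': "(p', c') \<in> parcs G" "(d', q') \<in> parcs G" "p' \<in> A" "c' \<in> C'" "d' \<in> C'" "q' \<in> B"
  shows "((T \<union> seg p c) \<union> (net C \<union> seg d q \<union> U)) \<inter> ((T' \<union> seg p' c') \<union> (net C' \<union> seg d' q' \<union> U')) \<subseteq> {a, b}"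
proof -
  have d: "A \<inter> C = {}" "A \<inter> C' = {}" "B \<inter> C = {}" "B \<inter> C' = {}"
    using disj(2) by auto
  note nets = net_disjoint[OF assms(1,2) disj(1)] net_disjoint[OF assms(1,3) d(1)] net_disjoint[OF assms(1,4) d(2)]
    net_disjoint[OF assms(2,3) d(3)] net_disjoint[OF assms(2,4) d(4)] net_disjoint[OF assms(3,4) disj(3)]
  have ne: "c \<notin> A" "c' \<notin> A" "d \<notin> A" "d' \<notin> A" "q \<notin> A" "q' \<notin> A"
    "c \<notin> B" "c' \<notin> B" "d \<notin> B" "d' \<notin> B" "p \<notin> B" "p' \<notin> B"
    "p \<notin> C" "p' \<notin> C" "c' \<notin> C" "d' \<notin> C" "q \<notin> C" "q' \<notin> C"
    "p \<notin> C'" "p' \<notin> C'" "c \<notin> C'" "d \<notin> C'" "q \<notin> C'" "q' \<notin> C'"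
    using d disj(1,3) e(3-) e'(3-) by auto
  have pA: "seg p c \<inter> net A \<subseteq> {pos p}" "seg p' c' \<inter> net A \<subseteq> {pos p'}"
    using seg_net[OF e(1) assms(1)] seg_net[OF e'(1) assms(1)] e(3) e'(3) ne by auto
  have qB: "seg d q \<inter> net B \<subseteq> {pos q}" "seg d' q' \<inter> net B \<subseteq> {pos q'}"
    using seg_net[OF e(2) assms(2)] seg_net[OF e'(2) assms(2)] e(6) e'(6) ne by auto
  have far: "seg u v \<inter> net S = {}" if "(u, v) \<in> parcs G" "S \<subseteq> pverts G" "{u, v} \<inter> S = {}" for u v S
    using seg_net[of u v S] that by auto
  have z: "seg p c \<inter> net B = {}" "seg p c \<inter> net C' = {}" "seg p' c' \<inter> net B = {}" "seg p' c' \<inter> net C = {}"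
    "seg d q \<inter> net A = {}" "seg d q \<inter> net C' = {}" "seg d' q' \<inter> net A = {}" "seg d' q' \<inter> net C = {}"
    by (intro far assms(1-4) e(1,2) e'(1,2); simp add: ne)+
  have n: "{p, c} \<inter> {p', c'} \<subseteq> {p} \<inter> {p'}" "{d, q} \<inter> {d', q'} \<subseteq> {q} \<inter> {q'}"
    "{p, c} \<inter> {d', q'} = {}" "{d, q} \<inter> {p', c'} = {}" 
    and n': "{p, c} \<noteq> {p', c'}" "{d, q} \<noteq> {d', q'}" "{p, c} \<noteq> {d', q'}" "{d, q} \<noteq> {p', c'}"
    using ne e(3-) e'(3-) by auto
  have s: "seg p c \<inter> seg p' c' \<subseteq> {pos p} \<inter> {pos p'}" "seg d q \<inter> seg d' q' \<subseteq> {pos q} \<inter> {pos q'}"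
    "seg p c \<inter> seg d' q' = {}" "seg d q \<inter> seg p' c' = {}"
    using subset_trans[OF seg_inter[OF e(1) e'(1) n'(1)] image_mono[OF n(1)]]
      subset_trans[OF seg_inter[OF e(2) e'(2) n'(2)] image_mono[OF n(2)]]
      seg_inter[OF e(1) e'(2) n'(3)] seg_inter[OF e(2) e'(1) n'(4)] n(3,4)
    by (auto split: if_splits)
  have t: "pos p \<in> T' \<Longrightarrow> pos p = a" "pos p' \<in> T \<Longrightarrow> pos p' = a"
    and u: "pos q \<in> U' \<Longrightarrow> pos q = b" "pos q' \<in> U \<Longrightarrow> pos q' = b"
    using T(3-5) U(3-5) by blast+
  have pp: "pos p = pos p' \<Longrightarrow> pos p = a" "pos q = pos q' \<Longrightarrow> pos q = b"
    using t(1) u(1) T(5) U(5) by simp_all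
  \<comment> \<open>Each strand has five pieces; the twenty-five pairs are treated one by
    one.\<close>
  have "T \<inter> T' \<subseteq> {a, b}" using T(3) by simp
  moreover have "T \<inter> seg p' c' \<subseteq> {a, b}" using T(1) pA(2) t(2) by fast
  moreover have "T \<inter> net C' \<subseteq> {a, b}" using T(1) nets(3) by blast
  moreover have "T \<inter> seg d' q' \<subseteq> {a, b}" using T(1) z(7) by blast
  moreover have "T \<inter> U' \<subseteq> {a, b}" using T(1) U(2) nets(1) by blast
  moreover have "seg p c \<inter> T' \<subseteq> {a, b}" using T(2) pA(1) t(1) by fast
  moreover have "seg p c \<inter> seg p' c' \<subseteq> {a, b}" using s(1) pp(1) by auto
  moreover have "seg p c \<inter> net C' \<subseteq> {a, b}" using z(2) by blast
  moreover have "seg p c \<inter> seg d' q' \<subseteq> {a, b}" using s(3) by blast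
  moreover have "seg p c \<inter> U' \<subseteq> {a, b}" using U(2) z(1) by blast
  moreover have "net C \<inter> T' \<subseteq> {a, b}" using T(2) nets(2) by blast
  moreover have "net C \<inter> seg p' c' \<subseteq> {a, b}" using z(4) by blast
  moreover have "net C \<inter> net C' \<subseteq> {a, b}" using nets(6) by blast
  moreover have "net C \<inter> seg d' q' \<subseteq> {a, b}" using z(8) by blast
  moreover have "net C \<inter> U' \<subseteq> {a, b}" using U(2) nets(4) by blast
  moreover have "seg d q \<inter> T' \<subseteq> {a, b}" using T(2) z(5) by blast
  moreover have "seg d q \<inter> seg p' c' \<subseteq> {a, b}" using s(4) by blast
  moreover have "seg d q \<inter> net C' \<subseteq> {a, b}" using z(6) by blast
  moreover have "seg d q \<inter> seg d' q' \<subseteq> {a, b}" using s(2) pp(2) by auto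
  moreover have "seg d q \<inter> U' \<subseteq> {a, b}" using U(2) qB(1) u(1) by fast
  moreover have "U \<inter> T' \<subseteq> {a, b}" using T(2) U(1) nets(1) by blast
  moreover have "U \<inter> seg p' c' \<subseteq> {a, b}" using U(1) z(3) by blast
  moreover have "U \<inter> net C' \<subseteq> {a, b}" using U(1) nets(5) by blast
  moreover have "U \<inter> seg d' q' \<subseteq> {a, b}" using U(1) qB(2) u(2) by fast
  moreover have "U \<inter> U' \<subseteq> {a, b}" using U(3) by simp
  ultimately show ?thesis
    by (simp only: Int_Un_distrib Int_Un_distrib2 Un_subset_iff simp_thms)
qed

text \<open>The strand splits at \<open>pos c\<close> into two closed parts that share only this
  point. A connected set joining \<open>a\<close> to \<open>b\<close> within the strand meets both
  parts and hence their overlap, so the arc must pass through \<open>pos c\<close>. This places a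
  vertex of each middle set on the theta curve.\<close>

lemma strand_arc:
  assumes "A \<subseteq> pverts G" "B \<subseteq> pverts G" "C \<subseteq> pverts G" "connected_in (parcs G) C"
    and disj: "A \<inter> B = {}" "(A \<union> B) \<inter> C = {}"
    and T: "T \<subseteq> net A" "a \<in> T" "pos p \<in> T" "closed T" "path_connected T"
    and U: "U \<subseteq> net B" "b \<in> U" "pos q \<in> U" "closed U" "path_connected U"
    and e: "(p, c) \<in> parcs G" "(d, q) \<in> parcs G" "p \<in> A" "c \<in> C" "d \<in> C" "q \<in> B"
  obtains g where "arc g" "pathstart g = a" "pathfinish g = b"
    "path_image g \<subseteq> (T \<union> seg p c) \<union> (net C \<union> seg d q \<union> U)" "pos c \<in> path_image g"
proof -
  let ?L = "T \<union> seg p c" and ?M = "net C \<union> seg d q \<union> U"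
  have d: "A \<inter> C = {}" "B \<inter> C = {}" using disj(2) by auto
  note nets = net_disjoint[OF assms(1,2) disj(1)] net_disjoint[OF assms(1,3) d(1)] net_disjoint[OF assms(2,3) d(2)]
  have ne: "c \<notin> A" "d \<notin> A" "q \<notin> A" "c \<notin> B" "d \<notin> B" "p \<notin> B" "p \<notin> C" "q \<notin> C"
    using d disj(1) e(3-) by auto
  have z: "seg p c \<inter> net B = {}" "seg d q \<inter> net A = {}" "seg p c \<inter> net C \<subseteq> {pos c}"
    using seg_net[OF e(1) assms(2)] seg_net[OF e(2) assms(1)] seg_net[OF e(1) assms(3)] ne by auto
  have n: "{p, c} \<noteq> {d, q}" "{p, c} \<inter> {d, q} \<subseteq> {c}" using e(3-) ne by auto
  have "T \<inter> net C \<subseteq> {pos c}" using T(1) nets(2) by blast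
  moreover have "T \<inter> seg d q \<subseteq> {pos c}" using T(1) z(2) by blast
  moreover have "T \<inter> U \<subseteq> {pos c}" using T(1) U(1) nets(1) by blast
  moreover have "seg p c \<inter> seg d q \<subseteq> {pos c}" using seg_inter[OF e(1,2) n(1)] n(2) by blast
  moreover have "seg p c \<inter> U \<subseteq> {pos c}" using U(1) z(1) by blast
  ultimately have LM: "?L \<inter> ?M \<subseteq> {pos c}"
    using z(3) by (simp only: Int_Un_distrib Int_Un_distrib2 Un_subset_iff simp_thms)
  have cl: "closed ?L" "closed ?M"
    using T U seg(5)[OF e(1)] seg(5)[OF e(2)] net_closed[OF assms(3)] by auto
  have cC: "pos c \<in> net C" "pos d \<in> net C" using e by (auto simp: net_def)
  have pL: "path_connected ?L"
    using T seg(2)[OF e(1)] by (intro path_connected_Un[OF T(5) seg(6)[OF e(1)]]) auto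
  have pm: "path_connected (net C \<union> seg d q)"
    using seg(2)[OF e(2)] cC
    by (intro path_connected_Un[OF net_path_connected[OF assms(4)] seg(6)[OF e(2)]]) auto
  have "pos q \<in> (net C \<union> seg d q) \<inter> U" using seg(3)[OF e(2)] U(3) by simp
  then have "(net C \<union> seg d q) \<inter> U \<noteq> {}" by (metis empty_iff)
  then have pM: "path_connected ?M" by (rule path_connected_Un[OF pm U(5)])
  have "pos c \<in> ?L \<inter> ?M" using seg(3)[OF e(1)] cC by simp
  then have "?L \<inter> ?M \<noteq> {}" by (metis empty_iff)
  then have pc: "path_connected (?L \<union> ?M)" by (rule path_connected_Un[OF pL pM])
  have "a \<noteq> b" using T U nets by auto
  then obtain g where g: "arc g" "path_image g \<subseteq> ?L \<union> ?M" "pathstart g = a" "pathfinish g = b"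
    using pc[unfolded path_connected_arcwise, rule_format, of a b] T(2) U(2) by auto
  have "path_image g \<inter> (?L \<inter> ?M) \<noteq> {}"
  proof
    assume n: "path_image g \<inter> (?L \<inter> ?M) = {}"
    have "a \<in> path_image g" "b \<in> path_image g" using g by auto
    then have "a \<in> ?L \<inter> path_image g" "b \<in> ?M \<inter> path_image g" using T(2) U(2) by simp_all
    then have "?L \<inter> path_image g \<noteq> {}" "?M \<inter> path_image g \<noteq> {}" by (metis empty_iff)+
    moreover have "connected (path_image g)" using g by (simp add: connected_arc_image)
    ultimately show False
      using connected_closedD[OF \<open>connected (path_image g)\<close> _ g(2) cl] n
      by (metis Int_commute)
  qed
  then have "pos c \<in> path_image g" using LM by auto
  then show ?thesis using g that by auto
qed

lemma net_drawing_points: "S \<subseteq> pverts G \<Longrightarrow> net S \<subseteq> drawing_points G pos \<gamma>"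
  by (auto simp: net_def drawing_points_def)

lemma seg_drawing_points: "(u, v) \<in> parcs G \<Longrightarrow> seg u v \<subseteq> drawing_points G pos \<gamma>"
  by (auto simp: drawing_points_def)

text \<open>The inside of a closed set is open and disjoint from its outside, hence from the closure
  of the outside; and the outside only shrinks when the set grows to the whole drawing.\<close>

lemma inside_not_outer:
  assumes "z \<in> inside C" "closed C" "C \<subseteq> drawing_points G pos \<gamma>"
  shows "z \<notin> frontier (outside (drawing_points G pos \<gamma>))"
proof
  assume "z \<in> frontier (outside (drawing_points G pos \<gamma>))"
  then have "z \<in> closure (outside (drawing_points G pos \<gamma>))" by (simp add: frontier_def)
  then have "z \<in> closure (outside C)"
    using closure_mono[OF outside_mono[OF assms(3)]] by (rule subsetD[rotated])
  moreover have "inside C \<inter> closure (outside C) = {}"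
    using open_Int_closure_eq_empty[OF open_inside[OF assms(2)], of "outside C"]
    by (simp add: inside_Int_outside)
  ultimately show False using assms(1) by blast
qed

text \<open>Tripods in \<open>net A\<close> and \<open>net B\<close>, with feet where the middle
  sets are attached, turn a minor into three arcs from \<open>a\<close> to \<open>b\<close> that
  meet only in their ends. The theta curve then hides one of the vertices \<open>c1\<close>,
  \<open>c2\<close>, \<open>c3\<close> inside a loop of the drawing, against
  \<open>outer\<close>.\<close>

theorem K23_minor_free_arcs:
  assumes outer: "\<And>v. v \<in> pverts G \<Longrightarrow> pos v \<in> frontier (outside (drawing_points G pos \<gamma>))"
  shows "K23_minor_free (parcs G)"
  unfolding K23_minor_free_def
proof (intro allI impI notI, elim conjE)
  fix A B C1 C2 C3
  assume conn: "connected_in (parcs G) A" "connected_in (parcs G) B" "connected_in (parcs G) C1"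
      "connected_in (parcs G) C2" "connected_in (parcs G) C3"
    and disj: "A \<inter> B = {}" "(A \<union> B) \<inter> (C1 \<union> C2 \<union> C3) = {}" "C1 \<inter> C2 = {}" "C1 \<inter> C3 = {}" "C2 \<inter> C3 = {}"
    and adj: "\<forall>C\<in>{C1, C2, C3}. linked (parcs G) A C \<and> linked (parcs G) C B"
  \<comment> \<open>A singleton is connected even if its element is no vertex, so one known vertex
    is assumed; reachability inside \<open>S\<close> yields the others.\<close>
  have sub: "S \<subseteq> pverts G" if S: "connected_in (parcs G) S" "x \<in> S" "x \<in> pverts G" for S x
  proof
    fix y assume "y \<in> S"
    then have "(x, y) \<in> (Restr (parcs G) S)\<^sup>*" using S by (auto simp: connected_in_def)
    then show "y \<in> pverts G"
      using S(3) by (induction rule: rtrancl_induct) (auto dest: arc_verts)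
  qed
  obtain p1 c1 d1 q1 where 1: "(p1, c1) \<in> parcs G" "(d1, q1) \<in> parcs G" "p1 \<in> A" "c1 \<in> C1" "d1 \<in> C1" "q1 \<in> B"
    using adj unfolding linked_def by (meson insertCI)
  obtain p2 c2 d2 q2 where 2: "(p2, c2) \<in> parcs G" "(d2, q2) \<in> parcs G" "p2 \<in> A" "c2 \<in> C2" "d2 \<in> C2" "q2 \<in> B"
    using adj unfolding linked_def by (meson insertCI)
  obtain p3 c3 d3 q3 where 3: "(p3, c3) \<in> parcs G" "(d3, q3) \<in> parcs G" "p3 \<in> A" "c3 \<in> C3" "d3 \<in> C3" "q3 \<in> B"
    using adj unfolding linked_def by (meson insertCI)
  have V: "A \<subseteq> pverts G" "B \<subseteq> pverts G" "C1 \<subseteq> pverts G" "C2 \<subseteq> pverts G" "C3 \<subseteq> pverts G"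
    using sub[OF conn(1) 1(3) arc_verts(1)[OF 1(1)]] sub[OF conn(2) 1(6) arc_verts(2)[OF 1(2)]]
      sub[OF conn(3) 1(4) arc_verts(2)[OF 1(1)]] sub[OF conn(4) 2(4) arc_verts(2)[OF 2(1)]]
      sub[OF conn(5) 3(4) arc_verts(2)[OF 3(1)]] by simp_all
  have inA: "pos p1 \<in> net A" "pos p2 \<in> net A" "pos p3 \<in> net A"
    using 1 2 3 by (auto simp: net_def)
  obtain a T1 T2 T3 where T: "T1 \<subseteq> net A" "T2 \<subseteq> net A" "T3 \<subseteq> net A"
      "{a, pos p1} \<subseteq> T1" "{a, pos p2} \<subseteq> T2" "{a, pos p3} \<subseteq> T3" "closed T1" "closed T2" "closed T3"
      "path_connected T1" "path_connected T2" "path_connected T3"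
      "T1 \<inter> T2 = {a}" "T1 \<inter> T3 = {a}" "T2 \<inter> T3 = {a}"
    using tripod[OF net_path_connected[OF conn(1)] inA] .
  have inB: "pos q1 \<in> net B" "pos q2 \<in> net B" "pos q3 \<in> net B"
    using 1 2 3 by (auto simp: net_def)
  obtain b U1 U2 U3 where U: "U1 \<subseteq> net B" "U2 \<subseteq> net B" "U3 \<subseteq> net B"
      "{b, pos q1} \<subseteq> U1" "{b, pos q2} \<subseteq> U2" "{b, pos q3} \<subseteq> U3" "closed U1" "closed U2" "closed U3"
      "path_connected U1" "path_connected U2" "path_connected U3"
      "U1 \<inter> U2 = {b}" "U1 \<inter> U3 = {b}" "U2 \<inter> U3 = {b}"
    using tripod[OF net_path_connected[OF conn(2)] inB] .
  have "(A \<union> B) \<inter> C1 = {}" "(A \<union> B) \<inter> C2 = {}" "(A \<union> B) \<inter> C3 = {}" 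
    "(A \<union> B) \<inter> (C1 \<union> C2) = {}" "(A \<union> B) \<inter> (C1 \<union> C3) = {}" "(A \<union> B) \<inter> (C2 \<union> C3) = {}"
    using disj(2) by auto
  note d = this
  have t: "a \<in> T1" "pos p1 \<in> T1" "a \<in> T2" "pos p2 \<in> T2" "a \<in> T3" "pos p3 \<in> T3"
    and u: "b \<in> U1" "pos q1 \<in> U1" "b \<in> U2" "pos q2 \<in> U2" "b \<in> U3" "pos q3 \<in> U3"
    using T(4-6) U(4-6) by auto
  obtain g1 where g1: "arc g1" "pathstart g1 = a" "pathfinish g1 = b"
    "path_image g1 \<subseteq> (T1 \<union> seg p1 c1) \<union> (net C1 \<union> seg d1 q1 \<union> U1)" "pos c1 \<in> path_image g1"
    by (rule strand_arc[OF V(1,2,3) conn(3) disj(1) d(1) T(1) t(1,2) T(7,10) U(1) u(1,2) U(7,10) 1])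
  obtain g2 where g2: "arc g2" "pathstart g2 = a" "pathfinish g2 = b"
    "path_image g2 \<subseteq> (T2 \<union> seg p2 c2) \<union> (net C2 \<union> seg d2 q2 \<union> U2)" "pos c2 \<in> path_image g2"
    by (rule strand_arc[OF V(1,2,4) conn(4) disj(1) d(2) T(2) t(3,4) T(8,11) U(2) u(3,4) U(8,11) 2])
  obtain g3 where g3: "arc g3" "pathstart g3 = a" "pathfinish g3 = b"
    "path_image g3 \<subseteq> (T3 \<union> seg p3 c3) \<union> (net C3 \<union> seg d3 q3 \<union> U3)" "pos c3 \<in> path_image g3"
    by (rule strand_arc[OF V(1,2,5) conn(5) disj(1) d(3) T(3) t(5,6) T(9,12) U(3) u(5,6) U(9,12) 3])
  have ends: "{a, b} \<subseteq> path_image g1" "{a, b} \<subseteq> path_image g2" "{a, b} \<subseteq> path_image g3"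
    using pathstart_in_path_image[of g1] pathfinish_in_path_image[of g1] pathstart_in_path_image[of g2]
      pathfinish_in_path_image[of g2] pathstart_in_path_image[of g3] pathfinish_in_path_image[of g3]
    unfolding g1(2,3) g2(2,3) g3(2,3) by simp_all
  have "path_image g1 \<inter> path_image g2 \<subseteq> {a, b}"
    by (rule subset_trans[OF Int_mono[OF g1(4) g2(4)]],
        rule strands_meet[OF V(1,2,3,4) disj(1) d(4) disj(3) T(1,2,13) t(2,4) U(1,2,13) u(2,4) 1 2])
  then have i12: "path_image g1 \<inter> path_image g2 = {a, b}" using ends by blast
  have "path_image g1 \<inter> path_image g3 \<subseteq> {a, b}"
    by (rule subset_trans[OF Int_mono[OF g1(4) g3(4)]],
        rule strands_meet[OF V(1,2,3,5) disj(1) d(5) disj(4) T(1,3,14) t(2,6) U(1,3,14) u(2,6) 1 3])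
  then have i13: "path_image g1 \<inter> path_image g3 = {a, b}" using ends by blast
  have "path_image g2 \<inter> path_image g3 \<subseteq> {a, b}"
    by (rule subset_trans[OF Int_mono[OF g2(4) g3(4)]],
        rule strands_meet[OF V(1,2,4,5) disj(1) d(6) disj(5) T(2,3,15) t(4,6) U(2,3,15) u(4,6) 2 3])
  then have i23: "path_image g2 \<inter> path_image g3 = {a, b}" using ends by blast
  have dp: "path_image g1 \<subseteq> drawing_points G pos \<gamma>" "path_image g2 \<subseteq> drawing_points G pos \<gamma>"
    "path_image g3 \<subseteq> drawing_points G pos \<gamma>"
    by (rule subset_trans[OF g1(4)], intro Un_least V[THEN net_drawing_points] 1(1,2)[THEN seg_drawing_points]
          subset_trans[OF T(1)] subset_trans[OF U(1)])
       (rule subset_trans[OF g2(4)], intro Un_least V[THEN net_drawing_points] 2(1,2)[THEN seg_drawing_points]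
          subset_trans[OF T(2)] subset_trans[OF U(2)],
        rule subset_trans[OF g3(4)], intro Un_least V[THEN net_drawing_points] 3(1,2)[THEN seg_drawing_points]
          subset_trans[OF T(3)] subset_trans[OF U(3)])
  have "a \<in> net A" "b \<in> net B" using T(1) U(1) t(1) u(1) by auto
  \<comment> \<open>The chosen vertices differ from the hub points, so they lie on the open arcs of
    which \<open>theta_arc_inside\<close> speaks.\<close>
  moreover have "pos c \<notin> net A \<union> net B" if "c \<in> C1 \<union> C2 \<union> C3" for c
  proof -
    have "pos c \<in> net (C1 \<union> C2 \<union> C3)" using that by (auto simp: net_def)
    moreover have "net A \<inter> net (C1 \<union> C2 \<union> C3) = {}" "net B \<inter> net (C1 \<union> C2 \<union> C3) = {}"
      using net_disjoint[OF V(1), of "C1 \<union> C2 \<union> C3"] net_disjoint[OF V(2), of "C1 \<union> C2 \<union> C3"] V(3-5) disj(2)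
      by (simp_all add: Int_Un_distrib2)
    ultimately show ?thesis by auto
  qed
  ultimately have cab: "pos c1 \<notin> {a, b}" "pos c2 \<notin> {a, b}" "pos c3 \<notin> {a, b}"
    using 1 2 3 by auto
  have out: "pos c1 \<in> frontier (outside (drawing_points G pos \<gamma>))" 
    "pos c2 \<in> frontier (outside (drawing_points G pos \<gamma>))"
    "pos c3 \<in> frontier (outside (drawing_points G pos \<gamma>))"
    using outer 1 2 3 V by auto
  have "path_image g1 - {a, b} \<subseteq> inside (path_image g2 \<union> path_image g3) \<or>
    path_image g2 - {a, b} \<subseteq> inside (path_image g1 \<union> path_image g3) \<or>
    path_image g3 - {a, b} \<subseteq> inside (path_image g1 \<union> path_image g2)"
    by (rule theta_arc_inside[OF g1(1) g2(1) g3(1) g1(2,3) g2(2,3) g3(2,3) i12 i13 i23])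
  then have "pos c1 \<in> inside (path_image g2 \<union> path_image g3) \<or>
    pos c2 \<in> inside (path_image g1 \<union> path_image g3) \<or> pos c3 \<in> inside (path_image g1 \<union> path_image g2)"
    using cab g1(5) g2(5) g3(5) by (meson DiffI subsetD)
  moreover have "closed (path_image g1)" "closed (path_image g2)" "closed (path_image g3)"
    using g1 g2 g3 by (auto simp: closed_arc_image)
  ultimately show False
    using inside_not_outer[OF _ closed_Un Un_least] out dp by (elim disjE) simp_all
qed

end

lemma outerplanar_imp_K23_minor_free:
  assumes "pair_graph G" "outerplanar G"
  shows "K23_minor_free (parcs G)"
proof -
  obtain pos \<gamma> where "plane_drawing G pos \<gamma>"
      "\<forall>v\<in>pverts G. pos v \<in> frontier (outside (drawing_points G pos \<gamma>))"
    using assms(2) unfolding outerplanar_def by blast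
  then show ?thesis
    using assms(1) drawn_graph.K23_minor_free_arcs[of G pos \<gamma>]
    by (auto simp: drawn_graph_def)
qed

section \<open>Unique maxima and connected sets\<close>

text \<open>Replaces \<open>Max\<close> by the winner itself, which an extension of the set keeps or
  replaces; it is false on the empty set.\<close>

definition strict_max_on :: "('a \<Rightarrow> nat) \<Rightarrow> 'a set \<Rightarrow> bool" where
  "strict_max_on c N \<longleftrightarrow> (\<exists>y\<in>N. \<forall>z\<in>N - {y}. c z < c y)"

lemma has_unique_max_iff:
  assumes "finite N" "N \<noteq> {}"
  shows "has_unique_max c N \<longleftrightarrow> strict_max_on c N"
proof
  assume "has_unique_max c N"
  then obtain y where y: "{u \<in> N. c u = Max (c ` N)} = {y}"
    unfolding has_unique_max_def using card_1_singletonE by blast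
  then have yN: "y \<in> N" "c y = Max (c ` N)" and uniq: "\<And>z. z \<in> N \<Longrightarrow> c z = Max (c ` N) \<Longrightarrow> z = y"
    by blast+
  have "c z < c y" if "z \<in> N - {y}" for z
  proof -
    have "c z \<le> Max (c ` N)" using that assms by simp
    moreover have "c z \<noteq> Max (c ` N)" using uniq that by blast
    ultimately show ?thesis using yN by simp
  qed
  then show "strict_max_on c N" unfolding strict_max_on_def using yN(1) by blast
next
  assume "strict_max_on c N"
  then obtain y where y: "y \<in> N" "\<And>z. z \<in> N - {y} \<Longrightarrow> c z < c y"
    unfolding strict_max_on_def by auto
  have "Max (c ` N) = c y"
    using assms y by (intro Max_eqI) (auto, metis DiffI order_less_imp_le order_refl singletonD)
  moreover have "{u \<in> N. c u = c y} = {y}" using y by fastforce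
  ultimately show "has_unique_max c N" by (simp add: has_unique_max_def)
qed

lemma strict_max_on_cong: "(\<And>z. z \<in> N \<Longrightarrow> c z = c' z) \<Longrightarrow> strict_max_on c N = strict_max_on c' N"
  unfolding strict_max_on_def by auto

lemma strict_max_on_insert:
  assumes "strict_max_on c N" "finite N" "u \<notin> N" "a \<noteq> Max (c ` N)"
  shows "strict_max_on (c(u := a)) (insert u N)"
proof -
  obtain y where y: "y \<in> N" "\<And>z. z \<in> N - {y} \<Longrightarrow> c z < c y"
    using assms unfolding strict_max_on_def by auto
  have "Max (c ` N) = c y"
    using assms(2) y by (intro Max_eqI) (auto, metis DiffI order_less_imp_le order_refl singletonD)
  then consider "a < c y" | "a > c y" using assms(4) by fastforce
  then show ?thesis
  proof cases
    case 1
    then show ?thesis unfolding strict_max_on_def using y assms(3) by (intro bexI[of _ y]) auto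
  next
    case 2
    have "c z < a" if "z \<in> N" for z using that y 2 by (cases "z = y") force+
    then show ?thesis unfolding strict_max_on_def using assms(3) by (intro bexI[of _ u]) auto
  qed
qed

lemma unused_color:
  assumes "finite F" "card F \<le> 2"
  obtains a :: nat where "a \<in> {1..3}" "a \<notin> F"
proof -
  have "\<not> {1..3} \<subseteq> F" using card_mono[OF assms(1), of "{1..3}"] assms(2) by auto
  then show ?thesis using that by blast
qed

text \<open>
  A vertex whose color is fixed last may take any color but the current maxima of the sets it joins.
\<close>
lemma extend_strict_max:
  fixes c :: "'a \<Rightarrow> nat" and N :: "'b \<Rightarrow> 'a set"
  assumes fin: "finite Q" "\<And>x. x \<in> X \<Longrightarrow> finite (N x)" and y: "y \<notin> Q"
    and good: "\<And>x. x \<in> X \<Longrightarrow> N x \<inter> Q \<noteq> {} \<Longrightarrow> strict_max_on c (N x \<inter> Q)"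
    and F: "finite F" "card F \<le> 2"
      "\<And>x. x \<in> X \<Longrightarrow> y \<in> N x \<Longrightarrow> N x \<inter> Q \<noteq> {} \<Longrightarrow> Max (c ` (N x \<inter> Q)) \<in> F"
  obtains a where "a \<in> {1..3}"
    "\<And>x. x \<in> X \<Longrightarrow> N x \<inter> insert y Q \<noteq> {} \<Longrightarrow> strict_max_on (c(y := a)) (N x \<inter> insert y Q)"
proof -
  obtain a where a: "a \<in> {1..3}" "a \<notin> F" using unused_color[OF F(1,2)] .
  have "strict_max_on (c(y := a)) (N x \<inter> insert y Q)" if x: "x \<in> X" "N x \<inter> insert y Q \<noteq> {}" for x
  proof (cases "y \<in> N x")
    case False
    then have eq: "N x \<inter> insert y Q = N x \<inter> Q" by auto
    have "strict_max_on c (N x \<inter> Q)" using good x eq by auto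
    moreover have "c z = (c(y := a)) z" if "z \<in> N x \<inter> Q" for z using that y by auto
    ultimately show ?thesis using eq strict_max_on_cong by metis
  next
    case True
    then have eq: "N x \<inter> insert y Q = insert y (N x \<inter> Q)" by auto
    show ?thesis
    proof (cases "N x \<inter> Q = {}")
      case True
      then show ?thesis unfolding eq by (simp add: strict_max_on_def)
    next
      case ne: False
      have "a \<noteq> Max (c ` (N x \<inter> Q))" using F(3)[OF x(1) True ne] a by auto
      then show ?thesis unfolding eq
        using good[OF x(1) ne] fin(1) y by (intro strict_max_on_insert) auto
    qed
  qed
  then show ?thesis using that a by blast
qed

section \<open>Connected sets, minors and longest paths\<close>

lemma connected_in_singleton [simp]: "connected_in E {x}"
  by (auto simp: connected_in_def)

lemma linkedI: "x \<in> S \<Longrightarrow> y \<in> T \<Longrightarrow> (x, y) \<in> E \<Longrightarrow> linked E S T"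
  by (auto simp: linked_def)

lemma Restr_rtrancl_mono: "S \<subseteq> T \<Longrightarrow> (x, y) \<in> (Restr E S)\<^sup>* \<Longrightarrow> (x, y) \<in> (Restr E T)\<^sup>*"
  by (rule subsetD[OF rtrancl_mono]) auto

lemma connected_in_Un:
  assumes "sym E" "connected_in E S" "connected_in E T" "linked E S T \<or> S \<inter> T \<noteq> {}"
  shows "connected_in E (S \<union> T)"
proof -
  let ?R = "(Restr E (S \<union> T))\<^sup>*"
  have sym: "(y, x) \<in> ?R" if "(x, y) \<in> ?R" for x y
  proof -
    have "sym ?R" using assms(1) by (intro sym_rtrancl) (auto simp: sym_def)
    then show ?thesis using that by (auto dest: symD)
  qed
  have S: "(x, y) \<in> ?R" if "x \<in> S" "y \<in> S" for x y
    using assms(2) that Restr_rtrancl_mono[of S "S \<union> T"] by (auto simp: connected_in_def)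
  have T: "(x, y) \<in> ?R" if "x \<in> T" "y \<in> T" for x y
    using assms(3) that Restr_rtrancl_mono[of T "S \<union> T"] by (auto simp: connected_in_def)
  obtain s t where st: "s \<in> S" "t \<in> T" "(s, t) \<in> ?R"
  proof (cases "linked E S T")
    case True
    then obtain s t where "s \<in> S" "t \<in> T" "(s, t) \<in> E" by (auto simp: linked_def)
    then show ?thesis by (intro that[of s t]) auto
  next
    case False
    then obtain s where "s \<in> S \<inter> T" using assms(4) by auto
    then show ?thesis by (intro that[of s s]) auto
  qed
  have ST: "(x, y) \<in> ?R" if "x \<in> S" "y \<in> T" for x y
    using S[OF that(1) st(1)] st(3) T[OF st(2) that(2)] by (meson rtrancl_trans)
  have "S \<union> T \<noteq> {}" using assms(2) by (auto simp: connected_in_def)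
  then show ?thesis
    unfolding connected_in_def using S T ST sym by blast
qed

lemma connected_in_add:
  assumes "sym E" "connected_in E S" "\<And>x. x \<in> X \<Longrightarrow> linked E {x} S" "finite X"
  shows "connected_in E (S \<union> X)"
  using assms(4,3)
proof (induction X)
  case empty
  then show ?case using assms(2) by simp
next
  case (insert x X)
  then have "connected_in E (S \<union> X)" by simp
  moreover have "linked E {x} (S \<union> X)" using insert.prems[of x] by (auto simp: linked_def)
  ultimately have "connected_in E ({x} \<union> (S \<union> X))"
    by (intro connected_in_Un[OF assms(1) connected_in_singleton]) auto
  then show ?case by (simp add: insert_commute Un_commute)
qed

text \<open>By symmetry all links may point from a middle set to a hub, and disjointness is split
  into pairs, so that a use only has to name its two hubs and three middle sets.\<close>

lemma K23_minor_freeD: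
  assumes "K23_minor_free E" "sym E"
    and "connected_in E A" "connected_in E B" "connected_in E C1" "connected_in E C2" "connected_in E C3"
    and "A \<inter> B = {}" "A \<inter> C1 = {}" "A \<inter> C2 = {}" "A \<inter> C3 = {}" "B \<inter> C1 = {}" "B \<inter> C2 = {}" "B \<inter> C3 = {}"
      "C1 \<inter> C2 = {}" "C1 \<inter> C3 = {}" "C2 \<inter> C3 = {}"
    and "linked E C1 A" "linked E C2 A" "linked E C3 A" "linked E C1 B" "linked E C2 B" "linked E C3 B"
  shows False
proof -
  have "linked E A C" if "linked E C A" for C
    using that assms(2) by (auto simp: linked_def dest: symD)
  moreover have "(A \<union> B) \<inter> (C1 \<union> C2 \<union> C3) = {}" using assms(9-14) by auto
  ultimately show False
    using assms(1)[unfolded K23_minor_free_def, rule_format, of A B C1 C2 C3] assms by simp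
qed

lemma connected_in_mono:
  "connected_in E S \<Longrightarrow> E \<subseteq> E' \<Longrightarrow> connected_in E' S"
  unfolding connected_in_def using rtrancl_mono[of "Restr E S" "Restr E' S"] by blast

lemma K23_minor_free_subset:
  assumes "K23_minor_free E" "E' \<subseteq> E"
  shows "K23_minor_free E'"
  unfolding K23_minor_free_def
proof (intro allI impI)
  fix A B C1 C2 C3
  assume *: "connected_in E' A \<and> connected_in E' B \<and>
     connected_in E' C1 \<and> connected_in E' C2 \<and> connected_in E' C3 \<and>
     A \<inter> B = {} \<and> (A \<union> B) \<inter> (C1 \<union> C2 \<union> C3) = {} \<and>
     C1 \<inter> C2 = {} \<and> C1 \<inter> C3 = {} \<and> C2 \<inter> C3 = {}"
  then have "\<not> (\<forall>C\<in>{C1, C2, C3}. linked E A C \<and> linked E C B)"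
    using assms(1)[unfolded K23_minor_free_def, rule_format, of A B C1 C2 C3] connected_in_mono[OF _ assms(2)]
    by simp
  moreover have "linked E S T" if "linked E' S T" for S T
    using that assms(2) by (auto simp: linked_def)
  ultimately show "\<not> (\<forall>C\<in>{C1, C2, C3}. linked E' A C \<and> linked E' C B)" by blast
qed

lemma card_ge3E:
  assumes "\<not> card S \<le> 2"
  obtains x y z where "x \<in> S" "y \<in> S" "z \<in> S" "x \<noteq> y" "x \<noteq> z" "y \<noteq> z"
proof -
  obtain T where "T \<subseteq> S" "card T = 3"
    using assms obtain_subset_with_card_n[of 3 S] by auto
  then show ?thesis using that by (auto simp: card_3_iff)
qed

text \<open>A longest path: a neighbor of an end that lay off the path would extend it. It is
  applied to the partners in a layer of servers and to the graph outside the cover.\<close>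

lemma maximal_path:
  assumes "finite W" "W \<noteq> {}" "symp R"
  obtains p where "p \<noteq> []" "distinct p" "set p \<subseteq> W" "successively R p"
    "\<And>v. v \<in> W \<Longrightarrow> R (hd p) v \<Longrightarrow> v \<in> set p" "\<And>v. v \<in> W \<Longrightarrow> R (last p) v \<Longrightarrow> v \<in> set p"
proof -
  define P where "P = (\<lambda>p. p \<noteq> [] \<and> distinct p \<and> set p \<subseteq> W \<and> successively R p)"
  obtain w where "w \<in> W" using assms(2) by auto
  then have "P [w]" by (auto simp: P_def)
  moreover have "\<forall>p. P p \<longrightarrow> length p \<le> card W"
    unfolding P_def using assms(1) by (metis card_mono distinct_card)
  ultimately obtain p where p: "P p" "\<And>q. P q \<Longrightarrow> length q \<le> length p"
    using ex_has_greatest_nat[of P "[w]" length "Suc (card W)"] by (metis less_Suc_eq_le)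
  have "v \<in> set p" if "v \<in> W" "R (hd p) v" for v
  proof (rule ccontr)
    assume "v \<notin> set p"
    then have "P (v # p)"
      using p(1) that assms(3) by (cases p) (auto simp: P_def dest: sympD)
    then show False using p(2)[of "v # p"] by simp
  qed
  moreover have "v \<in> set p" if "v \<in> W" "R (last p) v" for v
  proof (rule ccontr)
    assume "v \<notin> set p"
    then have "P (p @ [v])"
      using p(1) that by (auto simp: P_def successively_append_iff)
    then show False using p(2)[of "p @ [v]"] by simp
  qed
  ultimately show ?thesis using p(1) that unfolding P_def by blast
qed

section \<open>Serving clients with three colors\<close>

text \<open>\<open>X\<close> are the clients, which must see a unique maximum color, and
  \<open>Y\<close> the servers, the vertices to be colored. In the application the clients are the
  packing and the vertices outside its cover, the servers the remaining cover vertices.\<close>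

locale service_graph =
  fixes B :: "('a \<times> 'a) set" and X Y :: "'a set"
  assumes symB: "sym B" and bip: "B \<subseteq> X \<times> Y \<union> Y \<times> X" and XY: "X \<inter> Y = {}"
    and finX: "finite X" and finY: "finite Y" and K23: "K23_minor_free B"
begin

abbreviation N :: "'a \<Rightarrow> 'a set" where
  "N x \<equiv> B `` {x}"

lemma N_sub: "x \<in> X \<Longrightarrow> N x \<subseteq> Y"
  using bip XY by blast

lemma N_finite: "x \<in> X \<Longrightarrow> finite (N x)"
  using N_sub finY finite_subset by blast

lemma B_sym: "(x, y) \<in> B \<Longrightarrow> (y, x) \<in> B"
  using symB by (auto dest: symD)

end

text \<open>
  \<open>U\<close> is a connected set explored so far, \<open>X1\<close> are the clients adjacent to it that still
  have uncolored servers, \<open>W\<close> is the next layer of servers and \<open>X0\<close> are the clients not yet reached.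
\<close>
locale service_layer = service_graph +
  fixes U X1 W X0 :: "'a set"
  assumes U: "connected_in B U"
    and X1: "X1 \<subseteq> X" "X1 \<inter> U = {}" "\<And>x. x \<in> X1 \<Longrightarrow> linked B {x} U"
    and W: "W \<subseteq> Y" "W \<inter> U = {}" "\<And>w. w \<in> W \<Longrightarrow> linked B {w} X1"
    and X0: "X0 \<subseteq> X" "X0 \<inter> X1 = {}" "X0 \<inter> U = {}"
begin

text \<open>Each parent forbids one color to \<open>y\<close>, its current maximum.\<close>

definition parents :: "'a \<Rightarrow> 'a set" where
  "parents y = {x \<in> X1. (y, x) \<in> B}"

text \<open>A client in \<open>X0\<close> has at most two servers in the layer, so when one of them
  has been colored, it forbids exactly its own color to the other.\<close>

definition partner :: "'a \<Rightarrow> 'a \<Rightarrow> bool" where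
  "partner y q \<longleftrightarrow> y \<noteq> q \<and> (\<exists>x\<in>X0. (x, y) \<in> B \<and> (x, q) \<in> B)"

text \<open>Partners are joined in \<open>B\<close> only through a shared client; adding the
  unreached clients makes a path of partners usable as a connected branch set.\<close>

definition span :: "'a set \<Rightarrow> 'a set" where
  "span P = P \<union> {z \<in> X0. \<exists>w\<in>P. (z, w) \<in> B}"

lemma disj: "X1 \<inter> W = {}" "X0 \<inter> W = {}"
  using X1(1) X0(1) W(1) XY by auto

lemma finite_X0: "finite X0" and finite_X1: "finite X1" and finite_W: "finite W"
  using X1(1) X0(1) W(1) finX finY by (auto intro: finite_subset)

lemma finite_parents: "finite (parents y)"
  using finite_X1 by (simp add: parents_def)

lemma partner_sym: "symp partner"
  by (auto simp: partner_def symp_def)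

lemma connected_U_X1: "connected_in B (U \<union> X1)"
  using connected_in_add[OF symB U X1(3) finite_X1] .

text \<open>Three parents would be middle sets between the hubs \<open>{y}\<close> and
  \<open>U\<close>.\<close>

lemma parents_le2:
  assumes "y \<in> W"
  shows "card (parents y) \<le> 2"
proof (rule ccontr)
  assume "\<not> ?thesis"
  then obtain a b c where abc: "a \<in> parents y" "b \<in> parents y" "c \<in> parents y" "a \<noteq> b" "a \<noteq> c" "b \<noteq> c"
    by (rule card_ge3E)
  then have in1: "a \<in> X1" "b \<in> X1" "c \<in> X1" and e: "(a, y) \<in> B" "(b, y) \<in> B" "(c, y) \<in> B"
    by (auto simp: parents_def intro: B_sym)
  have "y \<notin> U" "y \<notin> X1" using assms W(2) disj(1) by auto
  moreover have "a \<notin> U" "b \<notin> U" "c \<notin> U" using in1 X1(2) by auto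
  moreover have "y \<noteq> a" "y \<noteq> b" "y \<noteq> c" using in1 assms disj(1) by auto
  ultimately show False
    by - (rule K23_minor_freeD[OF K23 symB connected_in_singleton[of _ y] U connected_in_singleton[of _ a]
        connected_in_singleton[of _ b] connected_in_singleton[of _ c]];
      (rule linkedI[OF singletonI singletonI e(1)] linkedI[OF singletonI singletonI e(2)]
        linkedI[OF singletonI singletonI e(3)] X1(3)[OF in1(1)] X1(3)[OF in1(2)] X1(3)[OF in1(3)]
       | use abc(4-6) in simp))
qed

text \<open>Three servers in the layer would be middle sets between the hubs \<open>{x}\<close> and
  \<open>U \<union> X1\<close>, which is connected and adjacent to all of \<open>W\<close>.\<close>

lemma clients_le2:
  assumes "x \<in> X0"
  shows "card (N x \<inter> W) \<le> 2"
proof (rule ccontr)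
  assume "\<not> ?thesis"
  then obtain a b c where abc: "a \<in> N x \<inter> W" "b \<in> N x \<inter> W" "c \<in> N x \<inter> W" "a \<noteq> b" "a \<noteq> c" "b \<noteq> c"
    by (rule card_ge3E)
  then have in1: "a \<in> W" "b \<in> W" "c \<in> W" and e: "(a, x) \<in> B" "(b, x) \<in> B" "(c, x) \<in> B"
    by (auto intro: B_sym)
  have x: "x \<notin> U \<union> X1" "x \<notin> W" using assms X0 disj(2) by auto
  have n: "w \<notin> U \<union> X1" "linked B {w} (U \<union> X1)" if "w \<in> W" for w
    using that W(2) W(3)[OF that] disj(1) by (auto simp: linked_def)
  have w: "a \<notin> U \<union> X1" "b \<notin> U \<union> X1" "c \<notin> U \<union> X1" "x \<noteq> a" "x \<noteq> b" "x \<noteq> c"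
    using n(1) in1 x(2) by auto
  show False
    by (rule K23_minor_freeD[OF K23 symB connected_in_singleton[of _ x] connected_U_X1
          connected_in_singleton[of _ a] connected_in_singleton[of _ b] connected_in_singleton[of _ c]];
      (rule linkedI[OF singletonI singletonI e(1)] linkedI[OF singletonI singletonI e(2)]
        linkedI[OF singletonI singletonI e(3)] n(2)[OF in1(1)] n(2)[OF in1(2)] n(2)[OF in1(3)]
       | use x(1) w abc(4-6) in simp))
qed

lemma connected_span:
  assumes "successively partner p" "p \<noteq> []" "set p \<subseteq> W"
  shows "connected_in B (span (set p))"
  using assms
proof (induction p)
  case (Cons w p)
  have "connected_in B ({w} \<union> {z \<in> X0. (z, w) \<in> B})"
    using finite_X0 by (intro connected_in_add[OF symB]) (auto simp: linked_def)
  moreover have "span (set [w]) = {w} \<union> {z \<in> X0. (z, w) \<in> B}" by (auto simp: span_def)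
  ultimately have w: "connected_in B (span (set [w]))" by simp
  show ?case
  proof (cases p)
    case Nil
    then show ?thesis using w by simp
  next
    case (Cons v p')
    then have "connected_in B (span (set p))" "partner w v"
      using Cons.IH Cons.prems by auto
    moreover from this obtain z where "z \<in> X0" "(z, w) \<in> B" "(z, v) \<in> B"
      by (auto simp: partner_def)
    then have "z \<in> span (set [w]) \<inter> span (set p)" using Cons by (auto simp: span_def)
    ultimately have "connected_in B (span (set [w]) \<union> span (set p))"
      using w by (intro connected_in_Un[OF symB]) auto
    moreover have "span (set [w]) \<union> span (set p) = span (set (w # p))" by (auto simp: span_def)
    ultimately show ?thesis by simp
  qed
qed simp

text \<open>A second partner on the path would close a cycle, which together with \<open>U\<close> yields a \<open>K\<^sub>2\<^sub>,\<^sub>3\<close>.\<close>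
lemma path_end_partners:
  assumes p: "p \<noteq> []" "distinct p" "set p \<subseteq> W" "successively partner p"
    and closed: "\<And>v. v \<in> Wc \<Longrightarrow> partner (hd p) v \<Longrightarrow> v \<in> set p"
  shows "card {q \<in> Wc. partner (hd p) q} \<le> 1"
proof -
  define y where "y = hd p"
  \<comment> \<open>The only possible partner is the successor of \<open>y\<close>. If
    \<open>p\<close> is just \<open>[y]\<close>, then \<open>hd []\<close> is an unspecified value,
    but the left-hand side is empty.\<close>
  have "{q \<in> Wc. partner y q} \<subseteq> {hd (tl p)}"
  proof
    fix q assume "q \<in> {q \<in> Wc. partner y q}"
    then have q: "partner y q" "q \<in> set p" using closed by (auto simp: y_def)
    then have qy: "q \<noteq> y" by (auto simp: partner_def)
    obtain ps where ps: "p = y # ps" using p(1) y_def by (cases p) auto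
    then obtain m r where mr: "ps = m @ q # r" using q(2) qy by (auto dest: split_list)
    show "q \<in> {hd (tl p)}"
    proof (cases "m = []")
      case True
      then show ?thesis using ps mr by simp
    next
      case m: False
      have parts: "partner y (hd m)" "successively partner m" "partner (last m) q"
        using p(4) m unfolding ps mr by (simp_all add: successively_Cons successively_append_iff)
      have mW: "set m \<subseteq> W" "q \<in> W" "y \<in> W" and yq: "y \<notin> set m" "q \<notin> set m"
        using p(2,3) unfolding ps mr by auto
      obtain x where x: "x \<in> X0" "(x, y) \<in> B" "(x, q) \<in> B" using q(1) by (auto simp: partner_def)
      \<comment> \<open>The client \<open>x\<close> already has the two servers \<open>y\<close> and
        \<open>q\<close> in the layer, so it stays outside the branch set
        \<open>span (set m)\<close>.\<close>
      have "(x, w) \<notin> B" if w: "w \<in> set m" for w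
      proof
        assume "(x, w) \<in> B"
        then have "{y, q, w} \<subseteq> N x \<inter> W" using x mW w by auto
        then have "card {y, q, w} \<le> 2"
          using clients_le2[OF x(1)] card_mono[of "N x \<inter> W" "{y, q, w}"] finite_W by fastforce
        moreover have "card {y, q, w} = 3" using qy w yq by (auto simp: card_insert_if)
        ultimately show False by simp
      qed
      moreover have "x \<notin> W" using x disj by auto
      ultimately have x_span: "x \<notin> span (set m)" using mW by (auto simp: span_def)
      have y_span: "y \<notin> span (set m)" "q \<notin> span (set m)"
        using yq mW disj(2) by (auto simp: span_def)
      have U_span: "(U \<union> X1) \<inter> span (set m) = {}"
        using mW W(2) X0 disj(1) by (auto simp: span_def)
      obtain z1 where z1: "z1 \<in> X0" "(z1, y) \<in> B" "(z1, hd m) \<in> B" using parts by (auto simp: partner_def)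
      obtain z2 where z2: "z2 \<in> X0" "(z2, last m) \<in> B" "(z2, q) \<in> B" using parts by (auto simp: partner_def)
      have zs: "z1 \<in> span (set m)" "z2 \<in> span (set m)"
        using z1 z2 m by (auto simp: span_def)
      have n: "w \<notin> U \<union> X1" "linked B (U \<union> X1) {w}" if "w \<in> W" for w
        using that W(2) W(3)[OF that] disj(1) by (auto simp: linked_def intro: B_sym)
      have xU: "x \<notin> U \<union> X1" "x \<noteq> y" "x \<noteq> q" using x X0 disj(2) mW by auto
      \<comment> \<open>The hubs are \<open>{y}\<close> and \<open>{q}\<close>; they are joined by
        the shared client \<open>x\<close>, by the explored part \<open>U \<union> X1\<close>, and
        by the piece of path between them.\<close>
      have False
        by (rule K23_minor_freeD[OF K23 symB connected_in_singleton[of _ y] connected_in_singleton[of _ q]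
            connected_in_singleton[of _ x] connected_U_X1 connected_span[OF parts(2) m mW(1)]])
          (use qy xU n(1)[OF mW(2)] n(1)[OF mW(3)] y_span x_span U_span n(2)[OF mW(2)] n(2)[OF mW(3)]
            linkedI[OF zs(1) singletonI z1(2)] linkedI[OF zs(2) singletonI z2(3)]
            linkedI[OF singletonI singletonI x(2)] linkedI[OF singletonI singletonI x(3)] in simp_all)
      then show ?thesis ..
    qed
  qed
  then have "card {q \<in> Wc. partner y q} \<le> card {hd (tl p)}" by (intro card_mono) auto
  then show ?thesis by (simp add: y_def)
qed

text \<open>If both ends have the same two parents, these are the hubs, and the two ends and
  \<open>U\<close> are the middle sets. Otherwise the last vertex has a further parent
  \<open>b\<close>, and \<open>a\<close>, \<open>a'\<close>, \<open>b\<close> lie between the hub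
  spanned by the path and \<open>U\<close>.\<close>

lemma path_end_parents:
  assumes p: "p \<noteq> []" "distinct p" "set p \<subseteq> W" "successively partner p" and ne: "hd p \<noteq> last p"
    and many: "\<not> card (parents (hd p)) \<le> 1" "\<not> card (parents (last p)) \<le> 1"
  shows False
proof -
  obtain a a' where a: "a \<in> parents (hd p)" "a' \<in> parents (hd p)" "a \<noteq> a'"
    using many(1) card_le_Suc0_iff_eq[OF finite_parents, of "hd p"] by auto
  have ends: "hd p \<in> set p" "last p \<in> set p" using p(1) by auto
  have eW: "hd p \<in> W" "last p \<in> W" using ends p(3) by auto
  have nU: "hd p \<notin> U" "last p \<notin> U" "hd p \<notin> X1" "last p \<notin> X1" using eW W(2) disj(1) by auto
  have aX: "a \<in> X1" "a' \<in> X1" "(a, hd p) \<in> B" "(a', hd p) \<in> B"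
    using a by (auto simp: parents_def intro: B_sym)
  have aU: "a \<notin> U" "a' \<notin> U" using aX X1(2) by auto
  have Ul: "linked B U {x}" if "x \<in> X1" for x
    using X1(3)[OF that] by (auto simp: linked_def intro: B_sym)
  show False
  proof (cases "parents (last p) \<subseteq> {a, a'}")
    case True
    have "card {a, a'} = 2" using a(3) by simp
    moreover have "card (parents (last p)) \<le> card {a, a'}" by (intro card_mono True) simp
    ultimately have "card (parents (last p)) = card {a, a'}" using many(2) by linarith
    then have "parents (last p) = {a, a'}" by (intro card_subset_eq True) simp
    then have l: "(a, last p) \<in> B" "(a', last p) \<in> B"
      by (auto simp: parents_def intro: B_sym)
    show False
      by (rule K23_minor_freeD[OF K23 symB connected_in_singleton[of _ a] connected_in_singleton[of _ a']
            connected_in_singleton[of _ "hd p"] connected_in_singleton[of _ "last p"] U];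
          (rule linkedI[OF singletonI singletonI B_sym[OF aX(3)]] linkedI[OF singletonI singletonI B_sym[OF aX(4)]]
            linkedI[OF singletonI singletonI B_sym[OF l(1)]] linkedI[OF singletonI singletonI B_sym[OF l(2)]]
            Ul[OF aX(1)] Ul[OF aX(2)]
           | use ne a(3) aU nU aX(1,2) in force))
  next
    case False
    then obtain b where b: "b \<in> parents (last p)" "b \<noteq> a" "b \<noteq> a'" by auto
    then have bX: "b \<in> X1" "(b, last p) \<in> B" "b \<notin> U" using X1(2) by (auto simp: parents_def intro: B_sym)
    have sp: "hd p \<in> span (set p)" "last p \<in> span (set p)" using ends by (auto simp: span_def)
    have "span (set p) \<inter> U = {}" "span (set p) \<inter> X1 = {}"
      using p(3) W(2) X0 disj by (auto simp: span_def)
    then have d: "span (set p) \<inter> U = {}" "a \<notin> span (set p)" "a' \<notin> span (set p)" "b \<notin> span (set p)"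
      using aX bX by auto
    show False
      by (rule K23_minor_freeD[OF K23 symB connected_span[OF p(4,1,3)] U connected_in_singleton[of _ a]
            connected_in_singleton[of _ a'] connected_in_singleton[of _ b]])
        (use d aU bX(3) b(2,3) a(3) X1(3)[OF aX(1)] X1(3)[OF aX(2)] X1(3)[OF bX(1)]
          linkedI[OF singletonI sp(1) aX(3)] linkedI[OF singletonI sp(1) aX(4)]
          linkedI[OF singletonI sp(2) bX(2)] in auto)
  qed
qed

text \<open>Both ends of a longest partner path in \<open>Wc\<close> have at most one partner there,
  and one of them has at most one parent, which adds up to two. A path of one vertex has no partner
  and at most two parents.\<close>

lemma light_server:
  assumes "Wc \<subseteq> W" "Wc \<noteq> {}"
  obtains y where "y \<in> Wc" "card (parents y) + card {q \<in> Wc. partner y q} \<le> 2"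
proof -
  obtain p where p: "p \<noteq> []" "distinct p" "set p \<subseteq> Wc" "successively partner p"
    and cl: "\<And>v. v \<in> Wc \<Longrightarrow> partner (hd p) v \<Longrightarrow> v \<in> set p" "\<And>v. v \<in> Wc \<Longrightarrow> partner (last p) v \<Longrightarrow> v \<in> set p"
    using maximal_path[OF finite_subset[OF assms(1) finite_W] assms(2) partner_sym] by blast
  have pW: "set p \<subseteq> W" using p(3) assms(1) by auto
  have ends: "hd p \<in> Wc" "last p \<in> Wc" using p by auto
  show ?thesis
  proof (cases "hd p = last p")
    case True
    then have "p = [hd p]" using p(1,2) by (cases p) (auto split: if_splits)
    then have "{q \<in> Wc. partner (hd p) q} = {}"
      using cl(1) by (metis (mono_tags, lifting) Collect_empty_eq empty_iff empty_set list.set_intros(1) partner_def set_ConsD)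
    then have "card {q \<in> Wc. partner (hd p) q} = 0" by (simp only: card.empty)
    then show ?thesis using that[OF ends(1)] parents_le2[of "hd p"] ends assms(1) by auto
  next
    case False
    have "successively partner (rev p)"
      using p(4) partner_sym unfolding successively_rev by (auto elim!: successively_mono dest: sympD)
    then have "card {q \<in> Wc. partner (last p) q} \<le> 1"
      using path_end_partners[of "rev p" Wc] p pW cl(2) by (simp add: hd_rev)
    moreover have "card {q \<in> Wc. partner (hd p) q} \<le> 1"
      using path_end_partners[of p Wc] p pW cl(1) by simp
    moreover have "card (parents (hd p)) \<le> 1 \<or> card (parents (last p)) \<le> 1"
      using path_end_parents[OF p(1,2) pW p(4) False] by blast
    ultimately show ?thesis using that[OF ends(1)] that[OF ends(2)] by linarith
  qed
qed

end

text \<open>A partial coloring: a client without colored servers imposes nothing yet.\<close>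

definition (in service_graph) served :: "('a \<Rightarrow> nat) \<Rightarrow> 'a set \<Rightarrow> bool" where
  "served c Q \<longleftrightarrow> c ` Q \<subseteq> {1..3} \<and> (\<forall>x\<in>X. N x \<inter> Q \<noteq> {} \<longrightarrow> strict_max_on c (N x \<inter> Q))"

text \<open>A light server \<open>y\<close> of \<open>Wc\<close> is set aside, the others are
  colored by induction, and \<open>y\<close> comes last. A client of \<open>y\<close> that already
  sees colors is either a parent, or it is unreached by \<open>Q\<close> and sees a single color,
  that of a partner. So at most two colors are forbidden.\<close>

lemma (in service_layer) color_layer:
  assumes Q: "finite Q" "Q \<inter> W = {}" "served c Q"
    and started: "\<And>x. x \<in> X \<Longrightarrow> N x \<inter> W \<noteq> {} \<Longrightarrow> N x \<inter> Q \<noteq> {} \<Longrightarrow> x \<in> X1"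
    and unreached: "\<And>x. x \<in> X \<Longrightarrow> N x \<inter> Q = {} \<Longrightarrow> x \<in> X0"
    and "Wc \<subseteq> W"
  shows "\<exists>c'. served c' (Q \<union> Wc)"
  using \<open>Wc \<subseteq> W\<close>
proof (induction "card Wc" arbitrary: Wc)
  case 0
  then have "Wc = {}" using finite_subset[OF _ finite_W] by simp
  then show ?case using Q(3) by auto
next
  case (Suc n)
  then have "Wc \<noteq> {}" by auto
  then obtain y where y: "y \<in> Wc" "card (parents y) + card {q \<in> Wc. partner y q} \<le> 2"
    using light_server[OF Suc.prems] by blast
  define R where "R = Q \<union> (Wc - {y})"
  have finWc: "finite Wc" using Suc.prems finite_W finite_subset by blast
  have "n = card (Wc - {y})" using Suc.hyps(2) y(1) finWc by simp
  then obtain c' where c': "served c' R"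
    using Suc.hyps(1)[of "Wc - {y}"] Suc.prems unfolding R_def by blast
  have yW: "y \<in> W" using y(1) Suc.prems by blast
  define F where "F = (\<lambda>x. Max (c' ` (N x \<inter> R))) ` parents y \<union> c' ` {q \<in> Wc. partner y q}"
  have finR: "finite R" "y \<notin> R" using Q(1,2) finWc yW by (auto simp: R_def)
  have F: "finite F" "card F \<le> 2"
  proof -
    show "finite F" using finite_parents finWc by (simp add: F_def)
    have "card F \<le> card ((\<lambda>x. Max (c' ` (N x \<inter> R))) ` parents y) + card (c' ` {q \<in> Wc. partner y q})"
      unfolding F_def by (rule card_Un_le)
    also have "\<dots> \<le> card (parents y) + card {q \<in> Wc. partner y q}"
      using finite_parents finWc by (intro add_mono card_image_le) auto
    finally show "card F \<le> 2" using y(2) by simp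
  qed
  have max_F: "Max (c' ` (N x \<inter> R)) \<in> F" if x: "x \<in> X" "y \<in> N x" "N x \<inter> R \<noteq> {}" for x
  proof (cases "N x \<inter> Q = {}")
    case False
    then have "x \<in> X1" using started[OF x(1)] x(2) yW by blast
    then have "x \<in> parents y" using x(2) B_sym by (auto simp: parents_def)
    then show ?thesis unfolding F_def by blast
  next
    case True
    then have x0: "x \<in> X0" using unreached x(1) by blast
    obtain q where q: "q \<in> N x" "q \<in> Wc" "q \<noteq> y" using x(3) True by (auto simp: R_def)
    have "w = q" if w: "w \<in> N x \<inter> R" for w
    proof (rule ccontr)
      assume "w \<noteq> q"
      have ww: "w \<in> N x" "w \<in> Wc" "w \<noteq> y" using w True by (auto simp: R_def)
      have "{w, q, y} \<subseteq> N x \<inter> W" using ww q x(2) yW Suc.prems by blast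
      then have "card {w, q, y} \<le> 2"
        using clients_le2[OF x0] card_mono[of "N x \<inter> W" "{w, q, y}"] finite_W by fastforce
      then show False using \<open>w \<noteq> q\<close> q(3) ww(3) by simp
    qed
    moreover have "q \<in> N x \<inter> R" using q by (simp add: R_def)
    ultimately have "N x \<inter> R = {q}" by blast
    moreover have "partner y q" using x0 q x(2) by (auto simp: partner_def)
    ultimately show ?thesis using q(2) by (simp add: F_def)
  qed
  have good: "strict_max_on c' (N x \<inter> R)" if "x \<in> X" "N x \<inter> R \<noteq> {}" for x
    using c' that by (simp add: served_def)
  obtain a where a: "a \<in> {1..3}"
    "\<And>x. x \<in> X \<Longrightarrow> N x \<inter> insert y R \<noteq> {} \<Longrightarrow> strict_max_on (c'(y := a)) (N x \<inter> insert y R)"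
    by (rule extend_strict_max[where N = "\<lambda>x. N x" and X = X and c = c',
          OF finR(1) N_finite finR(2) good F max_F]) (assumption | rule that)+
  have ins: "insert y R = Q \<union> Wc" using y(1) by (auto simp: R_def)
  have "(c'(y := a)) ` insert y R \<subseteq> {1..3}"
    using c' a(1) by (auto simp: served_def)
  then have "served (c'(y := a)) (Q \<union> Wc)"
    using a(2) unfolding served_def ins by blast
  then show ?case by blast
qed

section \<open>Exploration of the service graph layer by layer\<close>

context service_graph begin

text \<open>Invariant of a breadth-first search, with \<open>U\<close> as connected branch set for
  the minors of the next layer. Only clients that see both colored and uncolored servers must be
  attached to \<open>U\<close>, so components finished earlier leave no trace in it.\<close>

definition explored :: "'a set \<Rightarrow> 'a set \<Rightarrow> bool" where
  "explored Q U \<longleftrightarrow> connected_in B U \<and> U \<inter> Y \<subseteq> Q \<and> (\<forall>x\<in>X \<inter> U. N x \<inter> Q \<noteq> {}) \<and>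
     (\<forall>x\<in>X. N x \<inter> Q \<noteq> {} \<and> \<not> N x \<subseteq> Q \<longrightarrow> x \<notin> U \<and> linked B {x} U)"

text \<open>The uncolored servers of all unfinished clients form one layer, and coloring it finishes
  these clients. A client that is unfinished afterwards saw no color before and is adjacent to the
  layer, so \<open>U \<union> X1 \<union> W\<close> is the next witness.\<close>

lemma explore_layer:
  assumes Q: "Q \<subseteq> Y" "served c Q" and U: "explored Q U"
    and x: "x \<in> X" "N x \<inter> Q \<noteq> {}" "\<not> N x \<subseteq> Q"
  obtains c' W where "W \<noteq> {}" "W \<subseteq> Y - Q" "served c' (Q \<union> W)" "\<exists>U'. explored (Q \<union> W) U'"
proof -
  define X1 where "X1 = {x \<in> X. N x \<inter> Q \<noteq> {} \<and> \<not> N x \<subseteq> Q}"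
  define X0 where "X0 = {x \<in> X. N x \<inter> Q = {}}"
  define W where "W = {w \<in> Y - Q. \<exists>x\<in>X1. (x, w) \<in> B}"
  have UX: "connected_in B U" "U \<inter> Y \<subseteq> Q" "\<And>x. x \<in> X \<Longrightarrow> x \<in> U \<Longrightarrow> N x \<inter> Q \<noteq> {}"
    "\<And>x. x \<in> X1 \<Longrightarrow> x \<notin> U \<and> linked B {x} U"
    using U unfolding explored_def X1_def by blast+
  have Wlink: "linked B {w} X1" if "w \<in> W" for w
    using that B_sym by (auto simp: W_def linked_def)
  interpret L: service_layer B X Y U X1 W X0
  proof
    show "X1 \<inter> U = {}" "\<And>x. x \<in> X1 \<Longrightarrow> linked B {x} U" using UX(4) by auto
    show "W \<inter> U = {}" using UX(2) by (auto simp: W_def)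
    show "X0 \<inter> U = {}" using UX(3) by (auto simp: X0_def)
    show "connected_in B U" by (rule UX(1))
  qed (use Wlink in \<open>auto simp: X1_def X0_def W_def\<close>)
  have "\<exists>c'. served c' (Q \<union> W)"
  proof (rule L.color_layer[OF _ _ Q(2) _ _ subset_refl])
    show "finite Q" using Q(1) finY finite_subset by blast
    show "Q \<inter> W = {}" by (auto simp: W_def)
    show "x \<in> X1" if "x \<in> X" "N x \<inter> W \<noteq> {}" "N x \<inter> Q \<noteq> {}" for x
      using that by (auto simp: X1_def W_def)
    show "x \<in> X0" if "x \<in> X" "N x \<inter> Q = {}" for x
      using that by (auto simp: X0_def)
  qed
  then obtain c' where c': "served c' (Q \<union> W)" by blast
  have "x \<in> X1" using x by (simp add: X1_def)
  obtain w where w: "w \<in> N x" "w \<notin> Q" using x(3) by blast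
  have "w \<in> Y" using N_sub[OF x(1)] w(1) by blast
  then have W_ne: "W \<noteq> {}" using \<open>x \<in> X1\<close> w by (auto simp: W_def)
  have "explored (Q \<union> W) (U \<union> X1 \<union> W)"
    unfolding explored_def
  proof (intro conjI ballI impI)
    show "connected_in B (U \<union> X1 \<union> W)"
    proof (rule connected_in_add[OF symB L.connected_U_X1 _ L.finite_W])
      show "linked B {w} (U \<union> X1)" if "w \<in> W" for w
        using Wlink[OF that] by (auto simp: linked_def)
    qed
    show "(U \<union> X1 \<union> W) \<inter> Y \<subseteq> Q \<union> W"
      using UX(2) L.X1(1) XY by blast
    have "X \<inter> W = {}" using XY by (auto simp: W_def)
    then show "N z \<inter> (Q \<union> W) \<noteq> {}" if "z \<in> X \<inter> (U \<union> X1 \<union> W)" for z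
      using that UX(3)[of z] unfolding X1_def by blast
    fix z assume z: "z \<in> X" "N z \<inter> (Q \<union> W) \<noteq> {} \<and> \<not> N z \<subseteq> Q \<union> W"
    have full: "N v \<subseteq> Q \<union> W" if "v \<in> X1" for v
      using that N_sub[of v] L.X1(1) by (auto simp: W_def)
    then have z1: "z \<notin> X1" using z(2) by blast
    then have zQ: "N z \<inter> Q = {}" using z by (auto simp: X1_def)
    then have "N z \<inter> W \<noteq> {}" using z(2) by blast
    then show "linked B {z} (U \<union> X1 \<union> W)" by (auto simp: linked_def)
    show "z \<notin> U \<union> X1 \<union> W" using zQ z1 z(1) UX(3)[of z] \<open>X \<inter> W = {}\<close> by blast
  qed
  then show ?thesis using that[OF W_ne _ c'] by (auto simp: W_def)
qed

text \<open>The second disjunct describes the moment between two components: every client that sees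
  a color is finished, and a new search can begin at any uncolored server.\<close>

lemma serve_from:
  assumes "Q \<subseteq> Y" "served c Q"
    "(\<exists>U. explored Q U) \<or> (\<forall>x\<in>X. N x \<inter> Q \<noteq> {} \<longrightarrow> N x \<subseteq> Q)"
  shows "\<exists>c'. served c' Y"
  using assms
proof (induction "card (Y - Q)" arbitrary: Q c rule: less_induct)
  case less
  have smaller: "card (Y - (Q \<union> W)) < card (Y - Q)" if "W \<noteq> {}" "W \<subseteq> Y - Q" for W
    using that finY by (intro psubset_card_mono) auto
  show ?case
  proof (cases "\<exists>x\<in>X. N x \<inter> Q \<noteq> {} \<and> \<not> N x \<subseteq> Q")
    case True
    then obtain x U where x: "x \<in> X" "N x \<inter> Q \<noteq> {}" "\<not> N x \<subseteq> Q" and U: "explored Q U"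
      using less.prems(3) by blast
    obtain c' W where W: "W \<noteq> {}" "W \<subseteq> Y - Q" "served c' (Q \<union> W)" "\<exists>U'. explored (Q \<union> W) U'"
      by (rule explore_layer[OF less.prems(1,2) U x])
    have "Q \<union> W \<subseteq> Y" using W(2) less.prems(1) by blast
    then show ?thesis
      by (rule less.hyps[OF smaller[OF W(1,2)] _ W(3) disjI1[OF W(4)]])
  next
    case complete: False
    show ?thesis
    proof (cases "Y \<subseteq> Q")
      case True
      then show ?thesis using less.prems(1,2) by (metis subset_antisym)
    next
      case False
      then obtain y where y: "y \<in> Y" "y \<notin> Q" by blast
      \<comment> \<open>Finished clients have no uncolored server, so \<open>y\<close> is the first
        colored server of each of its clients and any color will do; 1 is taken.\<close>
      have new: "N x \<inter> Q = {}" if "x \<in> X" "y \<in> N x" for x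
        using complete that y(2) by blast
      have "strict_max_on (c(y := 1)) (N x \<inter> (Q \<union> {y}))" if x: "x \<in> X" "N x \<inter> (Q \<union> {y}) \<noteq> {}" for x
      proof (cases "y \<in> N x")
        case True
        then have "N x \<inter> (Q \<union> {y}) = {y}" using new[OF x(1)] by blast
        then show ?thesis by (simp add: strict_max_on_def)
      next
        case False
        then have eq: "N x \<inter> (Q \<union> {y}) = N x \<inter> Q" by blast
        then have "strict_max_on c (N x \<inter> Q)" using less.prems(2) x by (simp add: served_def)
        then show ?thesis unfolding eq
          by (subst strict_max_on_cong[of _ _ c]) (use y(2) in auto)
      qed
      moreover have "(c(y := 1)) ` (Q \<union> {y}) \<subseteq> {1..3}"
        using less.prems(2) by (auto simp: served_def)
      ultimately have c': "served (c(y := 1)) (Q \<union> {y})" unfolding served_def by blast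
      have "explored (Q \<union> {y}) {y}"
        unfolding explored_def
      proof (intro conjI ballI impI)
        fix x assume x: "x \<in> X" "N x \<inter> (Q \<union> {y}) \<noteq> {} \<and> \<not> N x \<subseteq> Q \<union> {y}"
        show "x \<notin> {y}" using x(1) y(1) XY by blast
        have "y \<in> N x" using complete x by blast
        then show "linked B {x} {y}" by (simp add: linked_def)
      qed (use y XY in auto)
      moreover have "Q \<union> {y} \<subseteq> Y" using y(1) less.prems(1) by blast
      ultimately show ?thesis
        using less.hyps[OF smaller[of "{y}"] _ c'] y by blast
    qed
  qed
qed

theorem service_coloring:
  assumes "\<And>x. x \<in> X \<Longrightarrow> N x \<noteq> {}"
  obtains c where "c ` Y \<subseteq> {1..3::nat}" "\<And>x. x \<in> X \<Longrightarrow> strict_max_on c (N x)"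
proof -
  have "\<exists>c'. served c' Y" by (rule serve_from[of "{}" "\<lambda>_. 1"]) (auto simp: served_def)
  then obtain c where c: "served c Y" by blast
  have "strict_max_on c (N x)" if "x \<in> X" for x
  proof -
    have eq: "N x \<inter> Y = N x" using N_sub[OF that] by blast
    have "N x \<inter> Y \<noteq> {}" unfolding eq by (rule assms[OF that])
    then have "strict_max_on c (N x \<inter> Y)" using c that unfolding served_def by blast
    then show ?thesis unfolding eq .
  qed
  then show ?thesis using that c by (auto simp: served_def)
qed

end

section \<open>Colorings of graphs without a \<open>K\<^sub>2\<^sub>,\<^sub>3\<close> minor\<close>

lemma connected_in_path:
  assumes "sym E" "successively (\<lambda>x y. (x, y) \<in> E) p" "p \<noteq> []"
  shows "connected_in E (set p)"
  using assms(2,3)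
proof (induction p)
  case (Cons x p)
  show ?case
  proof (cases p)
    case Nil
    then show ?thesis by simp
  next
    case (Cons y q)
    then have "connected_in E (set p)" "linked E {x} (set p)"
      using Cons.IH Cons.prems by (auto simp: linked_def)
    then have "connected_in E ({x} \<union> set p)" 
      by (intro connected_in_Un[OF assms(1) connected_in_singleton]) auto
    then show ?thesis by simp
  qed
qed simp

section \<open>Packings with a connected cover\<close>

locale K23_free_graph =
  fixes E :: "('a \<times> 'a) set" and V :: "'a set"
  assumes symE: "sym E" and loopless: "\<And>x. (x, x) \<notin> E" and EV: "E \<subseteq> V \<times> V"
    and finV: "finite V" and K23: "K23_minor_free E"
begin

definition ball :: "'a \<Rightarrow> 'a set" where
  "ball v = insert v (E `` {v})"

definition cover :: "'a set \<Rightarrow> 'a set" where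
  "cover D = (\<Union>d\<in>D. ball d)"

definition component :: "'a \<Rightarrow> 'a set" where
  "component v = E\<^sup>* `` {v}"

text \<open>The graph may be disconnected, so the cover is contracted separately in each component;
  this is the resulting branch set.\<close>

definition patch :: "'a set \<Rightarrow> 'a \<Rightarrow> 'a set" where
  "patch D v = cover D \<inter> component v"

definition packing :: "'a set \<Rightarrow> bool" where
  "packing D \<longleftrightarrow> D \<subseteq> V \<and> (\<forall>d\<in>D. \<forall>d'\<in>D. d \<noteq> d' \<longrightarrow> ball d \<inter> ball d' = {}) \<and>
     (\<forall>v\<in>V. patch D v = {} \<or> connected_in E (patch D v))"

lemma E_sym: "(x, y) \<in> E \<Longrightarrow> (y, x) \<in> E"
  using symE by (auto dest: symD)

lemma ball_sym: "x \<in> ball y \<Longrightarrow> y \<in> ball x"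
  by (auto simp: ball_def intro: E_sym)

lemma finite_nbhd: "finite (E `` {v})"
  using EV finV by (auto intro: finite_subset)

lemma component_refl: "v \<in> component v"
  by (simp add: component_def)

lemma component_eq: "w \<in> component v \<Longrightarrow> component w = component v"
proof -
  assume "w \<in> component v"
  then have vw: "(v, w) \<in> E\<^sup>*" by (simp add: component_def)
  then have wv: "(w, v) \<in> E\<^sup>*" using sym_rtrancl[OF symE] by (auto dest: symD)
  show ?thesis
    unfolding component_def using rtrancl_trans[OF vw] rtrancl_trans[OF wv] by blast
qed

lemma ball_component: "ball v \<subseteq> component v"
  by (auto simp: ball_def component_def)

lemma edge_component: "(v, w) \<in> E \<Longrightarrow> component w = component v"
  by (rule component_eq) (auto simp: component_def)

lemma connected_ball: "connected_in E (ball v)"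
proof -
  have "connected_in E ({v} \<union> E `` {v})"
    using finite_nbhd by (intro connected_in_add[OF symE]) (auto simp: linked_def intro: E_sym)
  then show ?thesis by (simp add: ball_def)
qed

text \<open>Only the patch in the component of \<open>v\<close> changes, which leaves one
  connectivity condition to check. For an empty patch it reduces to the connectivity of the
  ball.\<close>

lemma packing_insert:
  assumes D: "packing D" and v: "v \<in> V" "ball v \<inter> cover D = {}"
    and conn: "connected_in E (patch D v \<union> ball v)"
  shows "packing (insert v D)"
  unfolding packing_def
proof (intro conjI ballI impI)
  show "insert v D \<subseteq> V" using D v by (simp add: packing_def)
  have far: "ball v \<inter> ball d = {}" "ball d \<inter> ball v = {}" if "d \<in> D" for d
    using v(2) that unfolding cover_def by blast+
  show "ball d \<inter> ball d' = {}" if "d \<in> insert v D" "d' \<in> insert v D" "d \<noteq> d'" for d d'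
    using that far D unfolding packing_def by (elim insertE) simp_all
  have cov: "cover (insert v D) = cover D \<union> ball v" unfolding cover_def by blast
  show "patch (insert v D) w = {} \<or> connected_in E (patch (insert v D) w)" if w: "w \<in> V" for w
  proof (cases "w \<in> component v")
    case True
    then have "patch (insert v D) w = patch D v \<union> ball v"
      using component_eq[OF True] ball_component[of v] by (auto simp: patch_def cov)
    then show ?thesis using conn by simp
  next
    case False
    have "ball v \<inter> component w = {}"
    proof (rule ccontr)
      assume "ball v \<inter> component w \<noteq> {}"
      then obtain z where "z \<in> component v" "z \<in> component w" using ball_component[of v] by blast
      then have "component v = component w" using component_eq by metis
      then show False using False component_refl by blast
    qed
    then have "patch (insert v D) w = patch D w" by (auto simp: patch_def cov)
    then show ?thesis using D w by (simp add: packing_def)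
  qed
qed

lemma maximal_packing:
  obtains D where "packing D" "\<And>v. v \<in> V \<Longrightarrow> v \<notin> D \<Longrightarrow> \<not> packing (insert v D)"
proof -
  have "packing {}" by (simp add: packing_def patch_def cover_def)
  moreover have "\<forall>D. packing D \<longrightarrow> card D < Suc (card V)"
    using card_mono[OF finV] by (auto simp: packing_def le_imp_less_Suc)
  ultimately obtain D where D: "packing D" "\<And>D'. packing D' \<Longrightarrow> card D' \<le> card D"
    using ex_has_greatest_nat[of packing "{}" card "Suc (card V)"] by blast
  have "finite D" using D(1) finV finite_subset by (auto simp: packing_def)
  then have "\<not> packing (insert v D)" if "v \<notin> D" for v
    using that D(2)[of "insert v D"] by auto
  then show ?thesis using that D(1) by blast
qed

text \<open>
  A vertex at distance two from the cover could still be added to a maximal packing, since its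
  ball stays connected to the patch of its component.
\<close>
lemma dominating_packing:
  obtains D where "D \<subseteq> V" "\<And>d d'. d \<in> D \<Longrightarrow> d' \<in> D \<Longrightarrow> d \<noteq> d' \<Longrightarrow> ball d \<inter> ball d' = {}"
    "\<And>v. v \<in> V \<Longrightarrow> connected_in E (patch D v)"
    "\<And>r. r \<in> V \<Longrightarrow> r \<notin> cover D \<Longrightarrow> \<exists>s\<in>cover D. (r, s) \<in> E"
proof -
  obtain D where D: "packing D" "\<And>v. v \<in> V \<Longrightarrow> v \<notin> D \<Longrightarrow> \<not> packing (insert v D)"
    by (rule maximal_packing) (assumption | rule that)+
  have notD: "v \<notin> D" if "ball v \<inter> cover D = {}" for v
    using that by (auto simp: cover_def ball_def)
  \<comment> \<open>In a component that the cover misses, the ball of any vertex could be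
    added.\<close>
  have ne: "patch D v \<noteq> {}" if v: "v \<in> V" for v
  proof
    assume e: "patch D v = {}"
    then have "ball v \<inter> cover D = {}" using ball_component[of v] by (auto simp: patch_def)
    moreover have "connected_in E (patch D v \<union> ball v)" using e connected_ball by simp
    ultimately show False using packing_insert[OF D(1) v] D(2)[OF v] notD by blast
  qed
  have conn: "connected_in E (patch D v)" if "v \<in> V" for v
  proof -
    have "\<forall>v\<in>V. patch D v = {} \<or> connected_in E (patch D v)"
      using D(1) unfolding packing_def by (elim conjE)
    from bspec[OF this that] show ?thesis using ne[OF that] by (elim disjE) (rule notE)
  qed
  have adj: "\<exists>s\<in>cover D. (r, s) \<in> E" if r: "r \<in> V" "r \<notin> cover D" for r
  proof (rule ccontr)
    assume far: "\<not> ?thesis"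
    define Z where "Z = cover D \<union> {z. \<exists>s\<in>cover D. (z, s) \<in> E}"
    have rZ: "r \<notin> Z" using r far by (auto simp: Z_def)
    obtain t where t: "t \<in> patch D r" using ne[OF r(1)] by blast
    then have rt: "(r, t) \<in> E\<^sup>*" and tZ: "t \<in> Z" by (auto simp: patch_def component_def Z_def)
    \<comment> \<open>A walk from \<open>r\<close> to the patch has to step into \<open>Z\<close>.
      The vertex \<open>w\<close> before that step is at distance exactly two from the cover: its
      ball misses the cover, while \<open>z\<close> links the ball to it.\<close>
    have "\<exists>w z. (w, z) \<in> E \<and> w \<notin> Z \<and> z \<in> Z"
    proof (rule ccontr)
      assume stay: "\<not> ?thesis"
      from rt have "t \<notin> Z"
        by (induction rule: rtrancl_induct) (use rZ stay in blast)+
      then show False using tZ by simp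
    qed
    then obtain w z where wz: "(w, z) \<in> E" "w \<notin> Z" "z \<in> Z" by blast
    have w: "w \<in> V" "w \<notin> cover D" using wz EV by (auto simp: Z_def)
    have wn: "s \<notin> cover D" if "(w, s) \<in> E" for s using that wz(2) by (auto simp: Z_def)
    then obtain s where s: "s \<in> cover D" "(z, s) \<in> E" using wz(1,3) by (auto simp: Z_def)
    have disj: "ball w \<inter> cover D = {}" using w(2) wn by (auto simp: ball_def)
    have "component s = component w" using edge_component wz(1) s(2) by simp
    then have "s \<in> patch D w" using s(1) component_refl[of s] by (simp add: patch_def)
    moreover have "z \<in> ball w" using wz(1) by (simp add: ball_def)
    ultimately have "linked E (patch D w) (ball w)" using E_sym[OF s(2)] by (rule linkedI)
    then have "connected_in E (patch D w \<union> ball w)"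
      using conn[OF w(1)] connected_ball by (intro connected_in_Un[OF symE]) auto
    then show False using packing_insert[OF D(1) w(1) disj] D(2)[OF w(1)] notD[OF disj] by blast
  qed
  show ?thesis
  proof (rule that)
    show "D \<subseteq> V" using D(1) by (simp add: packing_def)
    show "ball d \<inter> ball d' = {}" if "d \<in> D" "d' \<in> D" "d \<noteq> d'" for d d'
      using D(1) that by (simp add: packing_def)
  qed (use conn adj in auto)
qed

end

section \<open>The graph outside the cover\<close>

locale packed_graph = K23_free_graph +
  fixes D :: "'a set"
  assumes DV: "D \<subseteq> V" and pack: "\<And>d d'. d \<in> D \<Longrightarrow> d' \<in> D \<Longrightarrow> d \<noteq> d' \<Longrightarrow> ball d \<inter> ball d' = {}"
    and conn: "\<And>v. v \<in> V \<Longrightarrow> connected_in E (patch D v)"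
    and dom: "\<And>r. r \<in> V \<Longrightarrow> r \<notin> cover D \<Longrightarrow> \<exists>s\<in>cover D. (r, s) \<in> E"
begin

definition rest :: "'a set" where
  "rest = V - cover D"

lemma rest_linked:
  assumes "r \<in> rest" "component r = component v"
  shows "linked E {r} (patch D v)"
proof -
  obtain s where s: "s \<in> cover D" "(r, s) \<in> E" using dom assms(1) by (auto simp: rest_def)
  have "s \<in> component v" using edge_component[OF s(2)] component_refl[of s] assms(2) by simp
  then show ?thesis using s by (auto simp: linked_def patch_def)
qed

lemma rest_disjoint: "r \<in> rest \<Longrightarrow> r \<notin> patch D v"
  by (simp add: rest_def patch_def)

lemma D_sub_cover: "D \<subseteq> cover D"
  by (auto simp: cover_def ball_def)

lemma cover_sub: "cover D \<subseteq> V"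
  using DV EV by (auto simp: cover_def ball_def)

text \<open>Three neighbors in \<open>rest\<close> would be middle sets between \<open>{r}\<close>
  and the patch of its component.\<close>

lemma rest_degree:
  assumes "r \<in> rest"
  shows "card (E `` {r} \<inter> rest) \<le> 2"
proof (rule ccontr)
  assume "\<not> ?thesis"
  then obtain a b c where abc: "a \<in> E `` {r} \<inter> rest" "b \<in> E `` {r} \<inter> rest" "c \<in> E `` {r} \<inter> rest"
      "a \<noteq> b" "a \<noteq> c" "b \<noteq> c"
    by (rule card_ge3E)
  then have e: "(r, a) \<in> E" "(r, b) \<in> E" "(r, c) \<in> E" and R: "a \<in> rest" "b \<in> rest" "c \<in> rest" by auto
  have ne: "r \<noteq> a" "r \<noteq> b" "r \<noteq> c" using e loopless by auto
  have rV: "r \<in> V" using assms by (simp add: rest_def)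
  note l = rest_linked[OF R(1) edge_component[OF e(1)]] rest_linked[OF R(2) edge_component[OF e(2)]]
    rest_linked[OF R(3) edge_component[OF e(3)]]
  note d = rest_disjoint[OF assms, of r] rest_disjoint[OF R(1), of r] rest_disjoint[OF R(2), of r] rest_disjoint[OF R(3), of r]
  show False
    by (rule K23_minor_freeD[OF K23 symE connected_in_singleton[of _ r] conn[OF rV]
          connected_in_singleton[of _ a] connected_in_singleton[of _ b] connected_in_singleton[of _ c]];
      (rule l linkedI[OF singletonI singletonI E_sym[OF e(1)]] linkedI[OF singletonI singletonI E_sym[OF e(2)]]
        linkedI[OF singletonI singletonI E_sym[OF e(3)]]
       | use ne d abc(4-6) in simp))
qed

text \<open>The hubs are \<open>a\<close> and \<open>c\<close>, two steps apart on the cycle; the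
  middle sets are \<open>b\<close>, the remainder \<open>q\<close> of the cycle, and the patch.
  Length at least four makes \<open>q\<close> nonempty.\<close>

lemma no_long_cycle:
  assumes p: "distinct p" "set p \<subseteq> rest" "successively (\<lambda>x y. (x, y) \<in> E) p" "length p \<ge> 4"
    and closing: "(hd p, last p) \<in> E"
  shows False
proof -
  obtain a b c q where p_eq: "p = a # b # c # q" "q \<noteq> []"
    using p(4) by (cases p; cases "tl p"; cases "tl (tl p)"; cases "tl (tl (tl p))") auto
  have e: "(a, b) \<in> E" "(b, c) \<in> E" "(c, hd q) \<in> E" "(a, last q) \<in> E" 
    and sq: "successively (\<lambda>x y. (x, y) \<in> E) q"
    using p(3) closing p_eq(2) unfolding p_eq(1) by (auto simp: successively_Cons)
  have R: "a \<in> rest" "b \<in> rest" "c \<in> rest" "set q \<subseteq> rest" using p(2) p_eq by auto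
  have ne: "a \<noteq> b" "a \<noteq> c" "b \<noteq> c" "a \<notin> set q" "b \<notin> set q" "c \<notin> set q" using p(1) p_eq by auto
  have aV: "a \<in> V" using R by (simp add: rest_def)
  have "component c = component a" using edge_component[OF e(1)] edge_component[OF e(2)] by simp
  note l = rest_linked[OF R(1) refl] rest_linked[OF R(3) this]
  have l': "linked E (patch D a) {a}" "linked E (patch D a) {c}"
    using l by (auto simp: linked_def intro: E_sym)
  have hl: "hd q \<in> set q" "last q \<in> set q" using p_eq(2) by auto
  have d: "set q \<inter> patch D a = {}" using R(4) rest_disjoint by blast
  show False
    by (rule K23_minor_freeD[OF K23 symE connected_in_singleton[of _ a] connected_in_singleton[of _ c]
          connected_in_singleton[of _ b] connected_in_path[OF symE sq p_eq(2)] conn[OF aV]];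
      (rule l' linkedI[OF singletonI singletonI E_sym[OF e(1)]] linkedI[OF singletonI singletonI e(2)]
        linkedI[OF hl(1) singletonI E_sym[OF e(3)]] linkedI[OF hl(2) singletonI E_sym[OF e(4)]]
       | use ne d rest_disjoint[OF R(1), of a] rest_disjoint[OF R(2), of a] rest_disjoint[OF R(3), of a] in auto))
qed

text \<open>The two neighbors on the path already exhaust the degree bound.\<close>

lemma path_neighbours:
  assumes p: "distinct p" "set p \<subseteq> rest" "successively (\<lambda>x y. (x, y) \<in> E) p"
    and i: "0 < i" "Suc i < length p"
  shows "E `` {p ! i} \<inter> rest = {p ! (i - 1), p ! (i + 1)}"
proof -
  have step: "(p ! k, p ! Suc k) \<in> E" if "Suc k < length p" for k
    using successively_nth[OF p(3) that] .
  have "(p ! (i - 1), p ! i) \<in> E" "(p ! i, p ! (i + 1)) \<in> E"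
    using step[of "i - 1"] step[of i] i by simp_all
  then have sub: "{p ! (i - 1), p ! (i + 1)} \<subseteq> E `` {p ! i} \<inter> rest"
    using p(2) i by (auto intro: E_sym simp: subset_iff)
  have "p ! (i - 1) \<noteq> p ! (i + 1)" using p(1) i by (simp add: nth_eq_iff_index_eq)
  then have "card {p ! (i - 1), p ! (i + 1)} = 2" by simp
  moreover have "p ! i \<in> rest" using p(2) i by (auto simp: subset_iff)
  ultimately have "card (E `` {p ! i} \<inter> rest) \<le> card {p ! (i - 1), p ! (i + 1)}"
    using rest_degree by simp
  then show ?thesis
    using card_seteq[OF _ sub] finite_nbhd by simp
qed

text \<open>A chord at an inner vertex would exceed the degree bound, and a chord between the two
  ends closes a cycle, which must be a triangle.\<close>

lemma path_chords:
  assumes p: "distinct p" "set p \<subseteq> rest" "successively (\<lambda>x y. (x, y) \<in> E) p"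
    and ij: "i < j" "j < length p" "(p ! i, p ! j) \<in> E"
  shows "j = Suc i \<or> i = 0 \<and> j = 2 \<and> length p = 3"
proof -
  have inR: "p ! k \<in> rest" if "k < length p" for k using p(2) that by (auto simp: subset_iff)
  consider "0 < i" | "Suc j < length p" | "i = 0" "Suc j = length p" using ij by linarith
  then show ?thesis
  proof cases
    case 1
    then have "p ! j \<in> {p ! (i - 1), p ! (i + 1)}"
      using path_neighbours[OF p, of i] ij inR[of j] by auto
    then show ?thesis using p(1) ij 1 by (auto simp: nth_eq_iff_index_eq)
  next
    case 2
    then have "p ! i \<in> {p ! (j - 1), p ! (j + 1)}"
      using path_neighbours[OF p, of j] ij inR[of i] E_sym by auto
    then show ?thesis using p(1) ij 2 by (auto simp: nth_eq_iff_index_eq)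
  next
    case 3
    then have "p \<noteq> []" by auto
    then have "(hd p, last p) \<in> E" using ij(3) 3 by (simp add: hd_conv_nth last_conv_nth flip: 3(2))
    then have "\<not> length p \<ge> 4" using no_long_cycle[OF p] by blast
    then show ?thesis using 3 ij by linarith
  qed
qed

text \<open>Offset 0 fails only if 3 divides \<open>n\<close>, when the last position
  \<open>n - 1\<close> would be left undominated; then offset 1 selects \<open>n - 2\<close> at the
  end.\<close>

lemma spaced_position:
  fixes i n :: nat
  assumes "i < n"
  obtains k where "k < n" "k mod 3 = (if n mod 3 = 0 then 1 else 0)" "k = i \<or> k = Suc i \<or> Suc k = i"
proof -
  have "\<exists>k<n. k mod 3 = (if n mod 3 = 0 then 1 else 0) \<and> (k = i \<or> k = Suc i \<or> Suc k = i)"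
    using assms by (cases "n mod 3 = 0"; simp; presburger)
  then show ?thesis using that by blast
qed

text \<open>Two selected positions that are both equal or next to a common position differ by at
  most two; this is what makes the domination unique.\<close>

lemma mod_3_inj:
  fixes l k :: nat
  assumes "l mod 3 = k mod 3" "l \<le> k + 2" "k \<le> l + 2"
  shows "l = k"
proof -
  have eq: "l = l div 3 * 3 + k mod 3" "k = k div 3 * 3 + k mod 3"
    using div_mult_mod_eq[of l 3] div_mult_mod_eq[of k 3] assms(1) by simp_all
  then have "l div 3 \<le> k div 3" "k div 3 \<le> l div 3" using assms(2,3) by linarith+
  then have "l div 3 = k div 3" by (rule antisym)
  then show ?thesis using eq by simp
qed

text \<open>
  The components of \<open>rest\<close> are paths and triangles; every third vertex of a path, with the offset
  chosen according to its length modulo 3, is adjacent or equal to each path vertex exactly once.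
\<close>
lemma efficient_domination:
  assumes "W \<subseteq> rest" "\<And>w. w \<in> W \<Longrightarrow> E `` {w} \<inter> rest \<subseteq> W"
  shows "\<exists>I\<subseteq>W. \<forall>w\<in>W. \<exists>!i. i \<in> I \<inter> ball w"
  using assms
proof (induction "card W" arbitrary: W rule: less_induct)
  case less
  have finW: "finite W" using less.prems(1) finV by (auto simp: rest_def intro: finite_subset)
  show ?case
  proof (cases "W = {}")
    case True
    then show ?thesis by auto
  next
    case False
    have "symp (\<lambda>x y. (x, y) \<in> E)" by (auto simp: symp_def intro: E_sym)
    from maximal_path[OF finW False this] obtain p where
      p: "p \<noteq> []" "distinct p" "set p \<subseteq> W" "successively (\<lambda>x y. (x, y) \<in> E) p" and
      ends: "\<And>v. v \<in> W \<Longrightarrow> (hd p, v) \<in> E \<Longrightarrow> v \<in> set p" "\<And>v. v \<in> W \<Longrightarrow> (last p, v) \<in> E \<Longrightarrow> v \<in> set p"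
      by metis
    have pR: "set p \<subseteq> rest" using p(3) less.prems(1) by blast
    \<comment> \<open>The path fills a whole component of \<open>W\<close>: its ends have no
      neighbor off it by maximality, its inner vertices by the degree bound.\<close>
    have closed: "v \<in> set p" if v: "u \<in> set p" "(u, v) \<in> E" "v \<in> W" for u v
    proof -
      obtain i where i: "i < length p" "u = p ! i" using v(1) by (auto simp: in_set_conv_nth)
      consider "u = hd p" | "u = last p" | "0 < i" "Suc i < length p"
        using i p(1) by (metis One_nat_def Suc_lessI diff_Suc_1 hd_conv_nth last_conv_nth neq0_conv)
      then show ?thesis
      proof cases
        case 3
        then have "v \<in> {p ! (i - 1), p ! (i + 1)}"
          using path_neighbours[OF p(2) pR p(4) 3] v i less.prems(1) by blast
        then show ?thesis using 3 by auto
      qed (use v ends in auto)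
    qed
    define W' where "W' = W - set p"
    have "hd p \<in> W" "hd p \<notin> W'" using hd_in_set[OF p(1)] p(3) by (auto simp: W'_def)
    moreover have "W' \<subseteq> W" by (simp add: W'_def)
    ultimately have "W' \<subset> W" by blast
    then have "card W' < card W" by (rule psubset_card_mono[OF finW])
    moreover have "W' \<subseteq> rest" using \<open>W' \<subseteq> W\<close> less.prems(1) by blast
    moreover have "E `` {w} \<inter> rest \<subseteq> W'" if w: "w \<in> W'" for w
    proof
      fix v assume v: "v \<in> E `` {w} \<inter> rest"
      have "w \<in> W" "w \<notin> set p" using w by (simp_all add: W'_def)
      moreover from this have "v \<in> W" using less.prems(2)[of w] v by blast
      moreover have "(v, w) \<in> E" using v E_sym by blast
      ultimately show "v \<in> W'" using closed[of v w] by (auto simp: W'_def)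
    qed
    ultimately have "\<exists>I'\<subseteq>W'. \<forall>w\<in>W'. \<exists>!i. i \<in> I' \<inter> ball w"
      by (rule less.hyps)
    then obtain I' where I': "I' \<subseteq> W'" "\<forall>w\<in>W'. \<exists>!i. i \<in> I' \<inter> ball w"
      by (elim exE conjE)
    define m where "m = (if length p mod 3 = 0 then 1 else 0 :: nat)"
    define I where "I = {p ! k | k. k < length p \<and> k mod 3 = m}"
    have Ip: "I \<subseteq> set p" by (auto simp: I_def)
    have uniq: "\<exists>!i. i \<in> (I \<union> I') \<inter> ball w" if w: "w \<in> W" for w
    proof (cases "w \<in> set p")
      case False
      then have "I \<inter> ball w = {}" using closed Ip w E_sym unfolding ball_def by blast
      then have "(I \<union> I') \<inter> ball w = I' \<inter> ball w" by blast
      then show ?thesis using bspec[OF I'(2), of w] w False by (simp add: W'_def)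
    next
      case True
      then have "I' \<inter> ball w = {}" using closed[OF True] I'(1) unfolding ball_def W'_def by blast
      then have eq: "(I \<union> I') \<inter> ball w = I \<inter> ball w" by blast
      obtain i where i: "i < length p" "w = p ! i" using True by (auto simp: in_set_conv_nth)
      obtain k where k: "k < length p" "k mod 3 = m" "k = i \<or> k = Suc i \<or> Suc k = i"
        using spaced_position[OF i(1)] unfolding m_def by blast
      have step: "(p ! l, p ! Suc l) \<in> E" if "Suc l < length p" for l
        using successively_nth[OF p(4) that] .
      have "p ! k \<in> ball w" unfolding i(2)
        using k(3) step[of i] step[of k] k(1) i(1) E_sym unfolding ball_def by auto
      moreover have "p ! k \<in> I" using k by (auto simp: I_def)
      ultimately have kI: "p ! k \<in> I \<inter> ball w" by simp
      have only: "z = p ! k" if z: "z \<in> I \<inter> ball w" for z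
      proof -
        obtain l where l: "l < length p" "l mod 3 = m" "z = p ! l" using z by (auto simp: I_def)
        have "p ! l = p ! i \<or> (p ! i, p ! l) \<in> E" using z l(3) i(2) by (auto simp: ball_def)
        then have "l = i \<or> l = Suc i \<or> Suc l = i \<or> length p = 3 \<and> (l = 0 \<or> l = 2)"
        proof
          assume e: "(p ! i, p ! l) \<in> E"
          then have "i \<noteq> l" using loopless by auto
          then show ?thesis
            using path_chords[OF p(2) pR p(4), of i l] path_chords[OF p(2) pR p(4), of l i] e E_sym[OF e] i(1) l(1)
            by linarith
        qed (use p(2) l(1) i(1) in \<open>simp add: nth_eq_iff_index_eq\<close>)
        \<comment> \<open>In a triangle the ends of the path see each other, but for length 3 the
          offset is 1, so neither end is selected.\<close>
        moreover have "\<not> (length p = 3 \<and> (l = 0 \<or> l = 2))" using l(2) by (auto simp: m_def)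
        ultimately have "l = i \<or> l = Suc i \<or> Suc l = i" by blast
        then have "l \<le> k + 2" "k \<le> l + 2" using k(3) by linarith+
        then have "l = k" using mod_3_inj[of l k] k(2) l(2) by simp
        then show ?thesis using l(3) by simp
      qed
      show ?thesis
        unfolding eq by (rule ex1I[of "\<lambda>i. i \<in> I \<inter> ball w", OF kI only])
    qed
    have sub: "I \<union> I' \<subseteq> W" using Ip p(3) I'(1) by (auto simp: W'_def)
    show ?thesis
      by (rule exI[of _ "I \<union> I'"], intro conjI sub ballI) (rule uniq)
  qed
qed

section \<open>The closed and the open coloring\<close>

lemma cover_center:
  assumes "v \<in> cover D"
  obtains d where "D \<inter> ball v = {d}"
proof -
  obtain d where d: "d \<in> D" "v \<in> ball d" using assms by (auto simp: cover_def)
  have "d' = d" if "d' \<in> D \<inter> ball v" for d'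
    using pack[of d' d] that d ball_sym[of d' v] by blast
  then have "D \<inter> ball v = {d}" using d ball_sym[OF d(2)] by blast
  then show ?thesis by (rule that)
qed

lemma rest_ball: "r \<in> rest \<Longrightarrow> D \<inter> ball r = {}"
  using ball_sym by (auto simp: rest_def cover_def)

lemma closed_coloring:
  "\<exists>c. c ` V \<subseteq> {1..3::nat} \<and> (\<forall>v\<in>V. strict_max_on c (ball v))"
proof -
  have "\<exists>I\<subseteq>rest. \<forall>r\<in>rest. \<exists>!i. i \<in> I \<inter> ball r"
    by (rule efficient_domination) simp_all
  then obtain I where I: "\<forall>r\<in>rest. \<exists>!i. i \<in> I \<inter> ball r"
    by (elim exE conjE)
  define c :: "'a \<Rightarrow> nat" where "c = (\<lambda>v. if v \<in> D then 3 else if v \<in> I then 2 else 1)"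
  have "strict_max_on c (ball v)" if v: "v \<in> V" for v
  proof (cases "v \<in> cover D")
    case True
    then obtain d where "D \<inter> ball v = {d}" by (rule cover_center)
    then have "d \<in> D" "d \<in> ball v" "\<And>z. z \<in> ball v - {d} \<Longrightarrow> z \<notin> D" by blast+
    then show ?thesis
      unfolding strict_max_on_def by (intro bexI[of _ d]) (auto simp: c_def)
  next
    case False
    then have r: "v \<in> rest" using v by (simp add: rest_def)
    obtain i where i: "i \<in> I" "i \<in> ball v" "\<And>z. z \<in> I \<Longrightarrow> z \<in> ball v \<Longrightarrow> z = i"
      using bspec[OF I r] by blast
    have noD: "z \<notin> D" if "z \<in> ball v" for z using rest_ball[OF r] that by blast
    have "c i = 2" using noD[OF i(2)] i(1) by (simp add: c_def)
    moreover have "c z = 1" if z: "z \<in> ball v - {i}" for z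
    proof -
      have "z \<notin> I" using i(3)[of z] z by blast
      then show ?thesis using noD[of z] z by (simp add: c_def)
    qed
    ultimately show ?thesis
      unfolding strict_max_on_def by (intro bexI[OF _ i(2)]) simp
  qed
  moreover have "c ` V \<subseteq> {1..3}" by (auto simp: c_def)
  ultimately show ?thesis by blast
qed

text \<open>The clients \<open>X\<close> lie in \<open>D \<union> rest\<close>, as the noncentral
  cover vertices will be served by the top color. A vertex of \<open>rest\<close> has no neighbor in
  \<open>D\<close>, so among the client neighborhoods it joins only those of its at most two
  neighbors in \<open>rest\<close>.\<close>

lemma color_rest:
  assumes base: "c ` S \<subseteq> {1..3::nat}" "finite S" "S \<inter> rest = {}" "X \<subseteq> V" "X \<inter> (cover D - D) = {}"
    and good: "\<And>x. x \<in> X \<Longrightarrow> strict_max_on c (E `` {x} \<inter> S)"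
    and "Q \<subseteq> rest"
  shows "\<exists>c'. c' ` (S \<union> Q) \<subseteq> {1..3} \<and> (\<forall>x\<in>X. strict_max_on c' (E `` {x} \<inter> (S \<union> Q)))"
proof -
  have "finite Q" using assms(7) finV by (auto simp: rest_def intro: finite_subset)
  then show ?thesis
    using assms(7)
  proof (induction Q)
    case empty
    then show ?case using base(1) good by (auto intro!: exI[of _ c])
  next
    case (insert u Q)
    then obtain c' where c': "c' ` (S \<union> Q) \<subseteq> {1..3}" "\<And>x. x \<in> X \<Longrightarrow> strict_max_on c' (E `` {x} \<inter> (S \<union> Q))"
      by blast
    have u: "u \<in> rest" "u \<notin> S \<union> Q" using insert base(3) by auto
    define F where "F = (\<lambda>x. Max (c' ` (E `` {x} \<inter> (S \<union> Q)))) ` (E `` {u} \<inter> rest)"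
    have finF: "finite F" using finite_nbhd by (simp add: F_def)
    have cardF: "card F \<le> 2"
      using card_image_le[of "E `` {u} \<inter> rest"] rest_degree[OF u(1)] finite_nbhd
      unfolding F_def by (meson finite_Int le_trans)
    have inF: "Max (c' ` (E `` {x} \<inter> (S \<union> Q))) \<in> F" if x: "x \<in> X" "u \<in> E `` {x}" for x
    proof -
      have ux: "(u, x) \<in> E" using x(2) E_sym by blast
      have "x \<notin> D" using rest_ball[OF u(1)] ux by (auto simp: ball_def)
      then have "x \<in> rest" using x(1) base(4,5) by (auto simp: rest_def)
      then show ?thesis using ux by (auto simp: F_def)
    qed
    have finSQ: "finite (S \<union> Q)" using base(2) insert by simp
    obtain a where a: "a \<in> {1..3}" 
      "\<And>x. x \<in> X \<Longrightarrow> E `` {x} \<inter> insert u (S \<union> Q) \<noteq> {} \<Longrightarrow> 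
          strict_max_on (c'(u := a)) (E `` {x} \<inter> insert u (S \<union> Q))"
      by (rule extend_strict_max[where N = "\<lambda>x. E `` {x}" and X = X and c = c',
            OF finSQ finite_nbhd u(2) c'(2) finF cardF inF]) (assumption | rule that)+
    have "E `` {x} \<inter> insert u (S \<union> Q) \<noteq> {}" if "x \<in> X" for x
      using c'(2)[OF that] by (auto simp: strict_max_on_def)
    then have "\<forall>x\<in>X. strict_max_on (c'(u := a)) (E `` {x} \<inter> (S \<union> insert u Q))"
      using a(2) by simp
    moreover have "(c'(u := a)) ` (S \<union> insert u Q) \<subseteq> {1..3}"
      using c'(1) a(1) u(2) by (auto simp: image_subset_iff)
    ultimately show ?case by blast
  qed
qed

lemma open_coloring:
  assumes nonisolated: "\<And>v. v \<in> V \<Longrightarrow> E `` {v} \<noteq> {}"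
  shows "\<exists>c. c ` V \<subseteq> {1..4::nat} \<and> (\<forall>v\<in>V. strict_max_on c (E `` {v}))"
proof -
  define S where "S = cover D - D"
  define X where "X = D \<union> rest"
  \<comment> \<open>Edges within one side are dropped: those inside \<open>rest\<close> are handled
    by \<open>color_rest\<close>, and vertices of \<open>S\<close> are served by their
    center.\<close>
  define B where "B = E \<inter> (X \<times> S \<union> S \<times> X)"
  have VV: "V = X \<union> S" "X \<inter> S = {}" 
    using D_sub_cover cover_sub by (auto simp: X_def S_def rest_def)
  have finXS: "finite X" "finite S" using finV VV(1) by auto
  have D_nbhd: "E `` {d} \<subseteq> S" if d: "d \<in> D" for d
  proof
    fix u assume u: "u \<in> E `` {d}"
    then have "u \<in> ball d" by (simp add: ball_def)
    moreover have "u \<noteq> d" using u loopless by auto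
    moreover have "u \<in> ball u" by (simp add: ball_def)
    ultimately have "u \<notin> D" using pack[of u d] d by blast
    then show "u \<in> S" using \<open>u \<in> ball d\<close> d by (auto simp: S_def cover_def)
  qed
  have rest_nbhd: "E `` {r} \<inter> D = {}" if "r \<in> rest" for r
    using rest_ball[OF that] by (auto simp: ball_def)
  \<comment> \<open>A center has a server because it is not isolated, a vertex of
    \<open>rest\<close> because it has a neighbor in the cover, which cannot be a center.\<close>
  have servers: "E `` {x} \<inter> S \<noteq> {}" if x: "x \<in> X" for x
  proof (cases "x \<in> D")
    case True
    then show ?thesis using D_nbhd[OF True] nonisolated[of x] DV by blast
  next
    case False
    then have r: "x \<in> rest" using x by (simp add: X_def)
    then obtain s where "s \<in> cover D" "(x, s) \<in> E" using dom by (auto simp: rest_def)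
    then show ?thesis using rest_nbhd[OF r] by (auto simp: S_def)
  qed
  have BX: "B `` {x} = E `` {x} \<inter> S" if "x \<in> X" for x
    using that VV(2) by (auto simp: B_def)
  interpret service_graph B X S
  proof
    show "sym B" using symE by (auto simp: B_def sym_def)
    show "K23_minor_free B" by (rule K23_minor_free_subset[OF K23]) (simp add: B_def)
  qed (use VV finXS in \<open>auto simp: B_def\<close>)
  obtain c where c: "c ` S \<subseteq> {1..3::nat}" "\<And>x. x \<in> X \<Longrightarrow> strict_max_on c (B `` {x})"
    using service_coloring servers BX by metis
  have "\<exists>c'. c' ` (S \<union> rest) \<subseteq> {1..3} \<and> (\<forall>x\<in>X. strict_max_on c' (E `` {x} \<inter> (S \<union> rest)))"
  proof (rule color_rest[OF c(1) finXS(2)])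
    show "strict_max_on c (E `` {x} \<inter> S)" if "x \<in> X" for x using c(2)[OF that] BX[OF that] by simp
    show "X \<inter> (cover D - D) = {}" using VV(2) by (simp add: S_def)
    show "S \<inter> rest = {}" by (auto simp: S_def rest_def)
    show "X \<subseteq> V" using VV(1) by blast
  qed simp
  then obtain c' where c': "c' ` (S \<union> rest) \<subseteq> {1..3}" "\<And>x. x \<in> X \<Longrightarrow> strict_max_on c' (E `` {x} \<inter> (S \<union> rest))"
    by blast
  define f where "f = (\<lambda>v. if v \<in> D then 4 else c' v)"
  have low: "f v \<in> {1..3}" if "v \<in> V" "v \<notin> D" for v
  proof -
    have "v \<in> X \<union> S" using that(1) VV(1) by simp
    then have "v \<in> S \<union> rest" using that(2) by (auto simp: X_def)
    then have "c' v \<in> {1..3}" using c'(1) by blast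
    then show ?thesis using that(2) by (simp add: f_def)
  qed
  have "strict_max_on f (E `` {v})" if v: "v \<in> V" for v
  proof (cases "v \<in> S")
    case True
    then obtain d where d: "D \<inter> ball v = {d}" using cover_center by (auto simp: S_def)
    have "v \<notin> D" using True by (simp add: S_def)
    have dv: "d \<in> D" "d \<in> ball v" using d by blast+
    then have "d \<in> E `` {v}" using \<open>v \<notin> D\<close> unfolding ball_def by blast
    have uniq: "z \<notin> D" if "z \<in> E `` {v}" "z \<noteq> d" for z
    proof
      assume "z \<in> D"
      moreover have "z \<in> ball v" using that(1) by (simp add: ball_def)
      ultimately have "z \<in> {d}" unfolding d[symmetric] by simp
      then show False using that(2) by simp
    qed
    have "f z < f d" if z: "z \<in> E `` {v} - {d}" for z
    proof -
      have "z \<notin> D" using uniq z by simp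
      moreover have "z \<in> V" using z EV by blast
      ultimately show ?thesis using low[of z] dv(1) by (simp add: f_def)
    qed
    then show ?thesis unfolding strict_max_on_def using \<open>d \<in> E `` {v}\<close> by blast
  next
    case False
    then have x: "v \<in> X" using v VV(1) by blast
    have sub: "E `` {v} \<subseteq> S \<union> rest" and noD: "E `` {v} \<inter> D = {}"
    proof -
      show noD: "E `` {v} \<inter> D = {}"
        using x D_nbhd[of v] rest_nbhd[of v] by (auto simp: X_def S_def)
      have "E `` {v} \<subseteq> V" using EV by blast
      then show "E `` {v} \<subseteq> S \<union> rest" using noD VV(1) unfolding X_def by blast
    qed
    have eq: "E `` {v} \<inter> (S \<union> rest) = E `` {v}" using sub by blast
    have "strict_max_on c' (E `` {v})" using c'(2)[OF x] unfolding eq .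
    moreover have "c' z = f z" if "z \<in> E `` {v}" for z using that noD by (auto simp: f_def)
    ultimately show ?thesis using strict_max_on_cong by metis
  qed
  moreover have "f ` V \<subseteq> {1..4}" using low by (fastforce simp: f_def)
  ultimately show ?thesis by blast
qed

end

context K23_free_graph begin

lemma packed: obtains D where "packed_graph E V D"
proof -
  obtain D where "D \<subseteq> V" "\<And>d d'. d \<in> D \<Longrightarrow> d' \<in> D \<Longrightarrow> d \<noteq> d' \<Longrightarrow> ball d \<inter> ball d' = {}"
    "\<And>v. v \<in> V \<Longrightarrow> connected_in E (patch D v)"
    "\<And>r. r \<in> V \<Longrightarrow> r \<notin> cover D \<Longrightarrow> \<exists>s\<in>cover D. (r, s) \<in> E"
    by (rule dominating_packing) (assumption | rule that)+
  then have "packed_graph E V D" by unfold_locales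
  then show ?thesis by (rule that)
qed

lemma closed_unique_max_coloring:
  "\<exists>c. c ` V \<subseteq> {1..3::nat} \<and> (\<forall>v\<in>V. strict_max_on c (insert v (E `` {v})))"
proof -
  obtain D where "packed_graph E V D" by (rule packed)
  from packed_graph.closed_coloring[OF this] show ?thesis by (simp add: ball_def)
qed

lemma open_unique_max_coloring:
  assumes "\<And>v. v \<in> V \<Longrightarrow> E `` {v} \<noteq> {}"
  shows "\<exists>c. c ` V \<subseteq> {1..4::nat} \<and> (\<forall>v\<in>V. strict_max_on c (E `` {v}))"
proof -
  obtain D where "packed_graph E V D" by (rule packed)
  from packed_graph.open_coloring[OF this assms] show ?thesis .
qed

end

section \<open>Lower bounds\<close>

definition parabola :: "nat \<Rightarrow> complex" where
  "parabola i = Complex (real i) ((real i)\<^sup>2)"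

lemma parabola_eq_iff [simp]: "parabola i = parabola j \<longleftrightarrow> i = j"
  by (auto simp: parabola_def)

text \<open>Over abscissa \<open>x\<close> the chord lies \<open>(x - i) * (j - x)\<close> above the
  parabola, so intersections of chords reduce to comparing two such products.\<close>

lemma chord_point:
  assumes "i < j" "z \<in> closed_segment (parabola i) (parabola j)"
  shows "real i \<le> Re z" "Re z \<le> real j" "Im z = (Re z)\<^sup>2 + (Re z - real i) * (real j - Re z)"
proof -
  obtain t where t: "0 \<le> t" "t \<le> 1" "z = (1 - t) *\<^sub>R parabola i + t *\<^sub>R parabola j"
    using assms(2) by (auto simp: in_segment)
  have re: "Re z = real i + t * (real j - real i)" and im: "Im z = (1 - t) * (real i)\<^sup>2 + t * (real j)\<^sup>2"
    by (simp_all add: t(3) parabola_def algebra_simps)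
  have d: "0 \<le> real j - real i" using assms(1) by simp
  show "real i \<le> Re z" using re mult_nonneg_nonneg[OF t(1) d] by simp
  show "Re z \<le> real j" using re mult_right_mono[OF t(2) d] by simp
  show "Im z = (Re z)\<^sup>2 + (Re z - real i) * (real j - Re z)"
    unfolding re im by (simp add: power2_eq_square algebra_simps)
qed

text \<open>Moving an end of a chord outwards raises the chord except over its fixed end, so equal
  heights force a common end or equal chords.\<close>

lemma nested_chords_meet:
  fixes i j k l x :: real
  assumes "i \<le> k" "k < l" "k \<le> x" "x \<le> l" "l \<le> j" "(x - i) * (j - x) = (x - k) * (l - x)"
  shows "x = i \<and> x = k \<or> x = l \<and> x = j \<or> i = k \<and> j = l"
proof -
  have "(x - k) * (l - x) \<le> (x - k) * (j - x)" using assms by (intro mult_left_mono) auto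
  moreover have "(x - k) * (j - x) \<le> (x - i) * (j - x)" using assms by (intro mult_right_mono) auto
  ultimately have "(x - k) * (l - x) = (x - k) * (j - x)" "(x - k) * (j - x) = (x - i) * (j - x)"
    using assms(6) by linarith+
  then show ?thesis using assms(2,5) by auto
qed

lemma chords_meet:
  assumes ij: "i < j" and kl: "k < l" and ne: "(i, j) \<noteq> (k, l)"
    and noncross: "\<not> (i < k \<and> k < j \<and> j < l)" "\<not> (k < i \<and> i < l \<and> l < j)"
    and z: "z \<in> closed_segment (parabola i) (parabola j)" "z \<in> closed_segment (parabola k) (parabola l)"
  shows "z \<in> parabola ` ({i, j} \<inter> {k, l})"
proof -
  note a = chord_point[OF ij z(1)] and b = chord_point[OF kl z(2)]
  have eq: "(Re z - real i) * (real j - Re z) = (Re z - real k) * (real l - Re z)"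
    using a(3) b(3) by simp
  have "\<exists>m\<in>{i, j} \<inter> {k, l}. Re z = real m"
  proof -
    consider "j \<le> k" | "l \<le> i" | "i \<le> k" "l \<le> j" | "k \<le> i" "j \<le> l" using ij kl noncross by linarith
    then show ?thesis
    proof cases
      case 1
      then show ?thesis using a b by (intro bexI[of _ j]) auto
    next
      case 2
      then show ?thesis using a b by (intro bexI[of _ i]) auto
    next
      case 3
      then show ?thesis using nested_chords_meet[of i k l "Re z" j] a b eq ne kl by auto
    next
      case 4
      then show ?thesis using nested_chords_meet[of k i j "Re z" l] a b eq ne ij by auto
    qed
  qed
  then obtain m where m: "m \<in> {i, j} \<inter> {k, l}" "Re z = real m" by blast
  then have "Im z = (real m)\<^sup>2" using a(3) by auto
  then have "z = parabola m" using m(2) by (simp add: parabola_def complex_eq_iff)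
  then show ?thesis using m(1) by blast
qed

definition above_parabola :: "complex set" where
  "above_parabola = {z. (Re z)\<^sup>2 \<le> Im z}"

lemma convex_above_parabola: "convex above_parabola"
proof (rule convexI)
  fix z w and u v :: real
  assume *: "z \<in> above_parabola" "w \<in> above_parabola" and uv: "0 \<le> u" "0 \<le> v" "u + v = 1"
  have v: "v = 1 - u" using uv(3) by simp
  \<comment> \<open>The convexity defect of the square is a weighted variance, hence
    nonnegative.\<close>
  have "(u * Re z + v * Re w)\<^sup>2 + u * v * (Re z - Re w)\<^sup>2 = u * (Re z)\<^sup>2 + v * (Re w)\<^sup>2"
    unfolding v by (simp add: power2_eq_square algebra_simps)
  moreover have "0 \<le> u * v * (Re z - Re w)\<^sup>2" using uv by simp
  moreover have "u * (Re z)\<^sup>2 \<le> u * Im z" "v * (Re w)\<^sup>2 \<le> v * Im w"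
    using * uv by (auto simp: above_parabola_def intro: mult_left_mono)
  ultimately show "u *\<^sub>R z + v *\<^sub>R w \<in> above_parabola" by (simp add: above_parabola_def)
qed

definition graph_on :: "(nat \<Rightarrow> 'a) \<Rightarrow> nat \<Rightarrow> (nat \<times> nat) set \<Rightarrow> 'a pair_pre_digraph" where
  "graph_on h n F = \<lparr>pverts = h ` {..<n}, parcs = map_prod h h ` (F \<union> F\<inverse>)\<rparr>"

text \<open>Indices are ordered along the parabola. One interleaving pattern captures both, since
  the two pairs range over all of \<open>F\<close>.\<close>

definition noncrossing :: "nat \<Rightarrow> (nat \<times> nat) set \<Rightarrow> bool" where
  "noncrossing n F \<longleftrightarrow> (\<forall>(i, j)\<in>F. i < j \<and> j < n) \<and>
     (\<forall>(i, j)\<in>F. \<forall>(k, l)\<in>F. \<not> (i < k \<and> k < j \<and> j < l))"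

locale convex_graph =
  fixes h :: "nat \<Rightarrow> 'a" and n :: nat and F :: "(nat \<times> nat) set"
  assumes inj: "inj h" and noncrossing: "noncrossing n F"
begin

abbreviation "G \<equiv> graph_on h n F"

lemma F_less: "(i, j) \<in> F \<Longrightarrow> i < j" "(i, j) \<in> F \<Longrightarrow> j < n"
  using noncrossing by (auto simp: noncrossing_def)

lemma F_noncrossing: "(i, j) \<in> F \<Longrightarrow> (k, l) \<in> F \<Longrightarrow> \<not> (i < k \<and> k < j \<and> j < l)"
  using noncrossing unfolding noncrossing_def by blast

lemma arcE:
  assumes "(u, v) \<in> parcs G"
  obtains i j where "(i, j) \<in> F" "u = h i \<and> v = h j \<or> u = h j \<and> v = h i"
  using assms by (auto simp: graph_on_def)

lemma pair_graph: "pair_graph G"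
proof -
  have "F \<subseteq> {..<n} \<times> {..<n}" using F_less by fastforce
  then have "finite F" by (rule finite_subset) simp
  then show ?thesis
    using inj F_less
    by unfold_locales (force simp: graph_on_def symmetric_def sym_def inj_eq dest: less_trans)+
qed

definition point :: "'a \<Rightarrow> complex" where
  "point v = parabola (inv h v)"

definition chord :: "'a \<times> 'a \<Rightarrow> real \<Rightarrow> complex" where
  "chord e = linepath (point (fst e)) (point (snd e))"

lemma point_h [simp]: "point (h i) = parabola i"
  using inj by (simp add: point_def)

lemma arc_segment:
  assumes "(u, v) \<in> parcs G"
  obtains i j where "(i, j) \<in> F" "{u, v} = {h i, h j}"
    "path_image (chord (u, v)) = closed_segment (parabola i) (parabola j)" "point u \<noteq> point v"
proof -
  obtain i j where ij: "(i, j) \<in> F" "u = h i \<and> v = h j \<or> u = h j \<and> v = h i" using arcE[OF assms] .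
  then have "i \<noteq> j" using F_less by blast
  then show ?thesis
    using ij by (intro that[of i j]) (auto simp: chord_def closed_segment_commute)
qed

lemma plane_drawing: "plane_drawing G point chord"
  unfolding plane_drawing_def
proof (intro conjI ballI; (elim case_prodE)?; clarify?)
  show "inj_on point (pverts G)"
    using inj by (auto simp: inj_on_def graph_on_def)
next
  fix u v assume uv: "(u, v) \<in> parcs G"
  obtain i j where ij: "(i, j) \<in> F" "{u, v} = {h i, h j}"
    "path_image (chord (u, v)) = closed_segment (parabola i) (parabola j)" "point u \<noteq> point v"
    using arc_segment[OF uv] .
  have "path_image (chord (u, v)) \<inter> point ` pverts G = {point u, point v}"
  proof
    show "{point u, point v} \<subseteq> path_image (chord (u, v)) \<inter> point ` pverts G"
      using ij(1,2) F_less[OF ij(1)] unfolding chord_def graph_on_def by (auto simp: doubleton_eq_iff)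
    show "path_image (chord (u, v)) \<inter> point ` pverts G \<subseteq> {point u, point v}"
    proof
      fix z assume "z \<in> path_image (chord (u, v)) \<inter> point ` pverts G"
      then obtain k where k: "z = parabola k" "parabola k \<in> closed_segment (parabola i) (parabola j)"
        using ij(3) by (auto simp: graph_on_def)
      have "(real k - real i) * (real j - real k) = 0"
        using chord_point(3)[OF F_less(1)[OF ij(1)] k(2)] by (simp add: parabola_def)
      then have "k = i \<or> k = j" by auto
      then have "z \<in> point ` {h i, h j}" using k(1) by auto
      then show "z \<in> {point u, point v}" unfolding ij(2)[symmetric] by simp
    qed
  qed
  then show "arc (chord (u, v)) \<and> pathstart (chord (u, v)) = point u \<and> pathfinish (chord (u, v)) = point v \<and>
      chord (v, u) = reversepath (chord (u, v)) \<and>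
      path_image (chord (u, v)) \<inter> point ` pverts G = {point u, point v}"
    using ij(4) by (simp add: chord_def arc_linepath)
next
  fix u v x y z assume e: "(u, v) \<in> parcs G" "(x, y) \<in> parcs G" "{u, v} \<noteq> {x, y}"
    and z: "z \<in> path_image (chord (u, v))" "z \<in> path_image (chord (x, y))"
  obtain i j where ij: "(i, j) \<in> F" "{u, v} = {h i, h j}"
    "path_image (chord (u, v)) = closed_segment (parabola i) (parabola j)"
    using arc_segment[OF e(1)] .
  obtain k l where kl: "(k, l) \<in> F" "{x, y} = {h k, h l}"
    "path_image (chord (x, y)) = closed_segment (parabola k) (parabola l)"
    using arc_segment[OF e(2)] .
  have "(i, j) \<noteq> (k, l)" using e(3) ij(2) kl(2) by auto
  then have "z \<in> parabola ` ({i, j} \<inter> {k, l})"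
    using chords_meet[OF F_less(1)[OF ij(1)] F_less(1)[OF kl(1)]] F_noncrossing ij kl z by metis
  then obtain m where "z = point (h m)" "h m \<in> {h i, h j} \<inter> {h k, h l}" by auto
  then show "z \<in> point ` ({u, v} \<inter> {x, y})" unfolding ij(2) kl(2) by blast
qed

lemma drawing_above: "drawing_points G point chord \<subseteq> above_parabola"
proof -
  have pt: "parabola i \<in> above_parabola" for i by (simp add: parabola_def above_parabola_def)
  have "path_image (chord e) \<subseteq> above_parabola" if e: "e \<in> parcs G" for e
  proof -
    obtain u v where uv: "e = (u, v)" by (cases e)
    show ?thesis
      unfolding chord_def uv by (simp add: point_def closed_segment_subset pt convex_above_parabola)
  qed
  moreover have "point ` pverts G \<subseteq> above_parabola" using pt by (auto simp: point_def)
  ultimately show ?thesis unfolding drawing_points_def by blast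
qed

text \<open>The drawing lies in the convex region above the parabola, so everything below belongs to
  the outer face, and each vertex is a limit of points straight below it.\<close>

lemma outerplanar: "outerplanar G"
  unfolding outerplanar_def
proof (intro exI conjI ballI, rule plane_drawing)
  fix v assume v: "v \<in> pverts G"
  let ?O = "outside (drawing_points G point chord)"
  obtain i where i: "v = h i" using v by (auto simp: graph_on_def)
  have "parabola i \<in> closure (- above_parabola)"
    unfolding closure_approachable
  proof (intro allI impI)
    fix e :: real assume e: "0 < e"
    have "Complex (real i) ((real i)\<^sup>2 - e / 2) \<in> - above_parabola"
      using e by (simp add: above_parabola_def)
    moreover have "dist (Complex (real i) ((real i)\<^sup>2 - e / 2)) (parabola i) < e"
      using e by (simp add: parabola_def dist_norm complex_norm minus_complex.ctr)
    ultimately show "\<exists>y\<in>- above_parabola. dist y (parabola i) < e" by blast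
  qed
  moreover have "- above_parabola \<subseteq> ?O"
    by (rule outside_subset_convex[OF convex_above_parabola drawing_above])
  ultimately have "point v \<in> closure ?O" using closure_mono i by auto
  moreover have "point v \<in> drawing_points G point chord" using v by (simp add: drawing_points_def)
  then have "point v \<notin> ?O" by (simp add: outside_def)
  then have "point v \<notin> interior ?O" using interior_subset by blast
  ultimately show "point v \<in> frontier ?O" by (simp add: frontier_def)
qed

definition nb :: "nat \<Rightarrow> nat set" where
  "nb i = {j. (i, j) \<in> F \<or> (j, i) \<in> F}"

lemma open_nbhd_h: "open_nbhd G (h i) = h ` nb i"
  using inj by (auto simp: open_nbhd_def graph_on_def nb_def inj_eq)

lemma closed_nbhd_h: "closed_nbhd G (h i) = h ` insert i (nb i)"
  by (simp add: closed_nbhd_def open_nbhd_h)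

lemma nb_finite: "finite (nb i)"
  by (rule finite_subset[of _ "{..<n}"]) (use F_less in \<open>force simp: nb_def dest: less_trans\<close>)+

lemma outerplanar_graphs: "G \<in> outerplanar_graphs"
  using pair_graph outerplanar by (simp add: outerplanar_graphs_def)

end

section \<open>From colorings to the invariants\<close>

lemma has_unique_color_iff:
  "has_unique_color c N \<longleftrightarrow> (\<exists>x\<in>N. \<forall>y\<in>N. c y = c x \<longrightarrow> y = x)"
proof
  assume "has_unique_color c N"
  then obtain i x where "{u \<in> N. c u = i} = {x}"
    unfolding has_unique_color_def using card_1_singletonE by metis
  then have "x \<in> N" "c x = i" "\<And>y. y \<in> N \<Longrightarrow> c y = i \<Longrightarrow> y = x" by blast+
  then show "\<exists>x\<in>N. \<forall>y\<in>N. c y = c x \<longrightarrow> y = x" by blast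
next
  assume "\<exists>x\<in>N. \<forall>y\<in>N. c y = c x \<longrightarrow> y = x"
  then obtain x where "x \<in> N" "\<forall>y\<in>N. c y = c x \<longrightarrow> y = x" by blast
  then have "{u \<in> N. c u = c x} = {x}" by auto
  then show "has_unique_color c N" unfolding has_unique_color_def by (intro exI[of _ "c x"]) simp
qed

lemma has_unique_color_image:
  assumes "inj h"
  shows "has_unique_color c (h ` A) \<longleftrightarrow> has_unique_color (c \<circ> h) A"
  using assms by (simp add: has_unique_color_iff inj_eq)

lemma strict_max_on_image:
  assumes "inj h"
  shows "strict_max_on c (h ` A) \<longleftrightarrow> strict_max_on (c \<circ> h) A"
proof -
  have "h ` A - {h y} = h ` (A - {y})" for y using assms by (auto simp: inj_eq)
  then show ?thesis by (simp add: strict_max_on_def)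
qed

lemma coloring_with_mono: "coloring_with G k c \<Longrightarrow> k \<le> l \<Longrightarrow> coloring_with G l c"
  by (fastforce simp: coloring_with_def)

text \<open>Refuting \<open>m\<close> colors is enough, because a coloring with fewer colors is also
  one with \<open>m\<close>. \<open>colorings_exist\<close> supplies the witness without which
  \<open>LEAST\<close> would say nothing.\<close>

lemma less_chi:
  assumes "pair_graph G"
  shows "(\<nexists>c. iCFc_coloring G m c) \<Longrightarrow> m < chi_iCFc G"
    "no_isolated_vertices G \<Longrightarrow> (\<nexists>c. iCFo_coloring G m c) \<Longrightarrow> m < chi_iCFo G"
    "no_isolated_vertices G \<Longrightarrow> (\<nexists>c. iUMo_coloring G m c) \<Longrightarrow> m < chi_iUMo G"
proof -
  have less: "m < (LEAST k. P k)" if "\<exists>k. P k" "\<And>k. P k \<Longrightarrow> k \<le> m \<Longrightarrow> P m" "\<not> P m" for P :: "nat \<Rightarrow> bool"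
    using LeastI_ex[OF that(1)] that(2,3) by (meson not_le)
  have mono: "iCFc_coloring G k c \<Longrightarrow> k \<le> m \<Longrightarrow> iCFc_coloring G m c"
    "iCFo_coloring G k c \<Longrightarrow> k \<le> m \<Longrightarrow> iCFo_coloring G m c"
    "iUMo_coloring G k c \<Longrightarrow> k \<le> m \<Longrightarrow> iUMo_coloring G m c" for k c
    using coloring_with_mono unfolding iCFc_coloring_def iCFo_coloring_def iUMo_coloring_def by blast+
  show "m < chi_iCFc G" if "\<nexists>c. iCFc_coloring G m c"
    unfolding chi_iCFc_def using colorings_exist(1)[OF assms] that mono(1)
    by (intro less[of "\<lambda>k. \<exists>c. iCFc_coloring G k c"]) blast+
  show "m < chi_iCFo G" if "no_isolated_vertices G" "\<nexists>c. iCFo_coloring G m c"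
    unfolding chi_iCFo_def using colorings_exist(3)[OF assms that(1)] that(2) mono(2)
    by (intro less[of "\<lambda>k. \<exists>c. iCFo_coloring G k c"]) blast+
  show "m < chi_iUMo G" if "no_isolated_vertices G" "\<nexists>c. iUMo_coloring G m c"
    unfolding chi_iUMo_def using colorings_exist(4)[OF assms that(1)] that(2) mono(3)
    by (intro less[of "\<lambda>k. \<exists>c. iUMo_coloring G k c"]) blast+
qed

lemma iUMc_imp_iCFc:
  assumes "iUMc_coloring G k c"
  shows "iCFc_coloring G k c"
  using assms unfolding iUMc_coloring_def iCFc_coloring_def has_unique_max_def has_unique_color_def by blast

lemma iUMo_imp_iCFo:
  assumes "iUMo_coloring G k c"
  shows "iCFo_coloring G k c"
  using assms unfolding iUMo_coloring_def iCFo_coloring_def has_unique_max_def has_unique_color_def by blast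

text \<open>Carries the lower bound of (b) over to (d).\<close>

lemma chi_iCFc_le_chi_iUMc:
  assumes "pair_graph G"
  shows "chi_iCFc G \<le> chi_iUMc G"
proof -
  have "\<exists>c. iUMc_coloring G (chi_iUMc G) c"
    unfolding chi_iUMc_def using colorings_exist(2)[OF assms] by (rule LeastI_ex)
  then show ?thesis
    unfolding chi_iCFc_def using iUMc_imp_iCFc by (metis (mono_tags, lifting) Least_le)
qed

lemma outerplanar_K23_free_graph:
  assumes "G \<in> outerplanar_graphs"
  shows "K23_free_graph (parcs G) (pverts G)"
proof -
  have G: "pair_graph G" "outerplanar G" using assms by (auto simp: outerplanar_graphs_def)
  interpret pair_graph G by (rule G(1))
  show ?thesis
  proof
    show "sym (parcs G)" using sym_arcs by (simp add: symmetric_def)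
    show "(x, x) \<notin> parcs G" for x using no_loops by force
    show "parcs G \<subseteq> pverts G \<times> pverts G" using arc_fst_in_verts arc_snd_in_verts by force
    show "finite (pverts G)" by (rule pair_finite_verts)
    show "K23_minor_free (parcs G)" by (rule outerplanar_imp_K23_minor_free[OF G])
  qed
qed

lemma outerplanar_finite_nbhd:
  assumes "G \<in> outerplanar_graphs"
  shows "finite (open_nbhd G v)" "finite (closed_nbhd G v)"
proof -
  interpret pair_graph G using assms by (simp add: outerplanar_graphs_def)
  show "finite (open_nbhd G v)"
    using open_nbhd_subset[OF pair_graph_axioms] pair_finite_verts by (rule finite_subset)
  then show "finite (closed_nbhd G v)" by (simp add: closed_nbhd_def)
qed

lemma outerplanar_iUMc:
  assumes "G \<in> outerplanar_graphs"
  shows "\<exists>c. iUMc_coloring G 3 c"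
proof -
  interpret K23_free_graph "parcs G" "pverts G" by (rule outerplanar_K23_free_graph[OF assms])
  obtain c where c: "c ` pverts G \<subseteq> {1..3::nat}"
    "\<forall>v\<in>pverts G. strict_max_on c (insert v (parcs G `` {v}))"
    using closed_unique_max_coloring by (elim exE conjE)
  have eq: "insert v (parcs G `` {v}) = closed_nbhd G v" for v
    by (auto simp: closed_nbhd_def open_nbhd_def)
  have "has_unique_max c (closed_nbhd G v)" if "v \<in> pverts G" for v
    using c(2) that has_unique_max_iff[OF outerplanar_finite_nbhd(2)[OF assms]]
    unfolding eq by (metis closed_nbhd_def insert_not_empty)
  then show ?thesis using c(1) by (auto simp: iUMc_coloring_def coloring_with_def)
qed

lemma outerplanar_iUMo:
  assumes "G \<in> outerplanar_graphs" "no_isolated_vertices G"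
  shows "\<exists>c. iUMo_coloring G 4 c"
proof -
  interpret K23_free_graph "parcs G" "pverts G" by (rule outerplanar_K23_free_graph[OF assms(1)])
  have eq: "parcs G `` {v} = open_nbhd G v" for v by (auto simp: open_nbhd_def)
  have ne: "open_nbhd G v \<noteq> {}" if "v \<in> pverts G" for v
    using assms(2) that by (simp add: no_isolated_vertices_def)
  obtain c where c: "c ` pverts G \<subseteq> {1..4::nat}" "\<forall>v\<in>pverts G. strict_max_on c (open_nbhd G v)"
    using open_unique_max_coloring[unfolded eq, OF ne] by blast
  have "has_unique_max c (open_nbhd G v)" if "v \<in> pverts G" for v
    using c(2) that has_unique_max_iff[OF outerplanar_finite_nbhd(1)[OF assms(1)] ne[OF that]] by blast
  then show ?thesis using c(1) by (auto simp: iUMo_coloring_def coloring_with_def)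
qed

lemma outerplanar_chi_le:
  assumes "G \<in> outerplanar_graphs"
  shows "chi_iCFc G \<le> 3" "chi_iUMc G \<le> 3"
    "no_isolated_vertices G \<Longrightarrow> chi_iCFo G \<le> 4" "no_isolated_vertices G \<Longrightarrow> chi_iUMo G \<le> 4"
proof -
  show "chi_iUMc G \<le> 3"
    unfolding chi_iUMc_def by (rule Least_le) (rule outerplanar_iUMc[OF assms])
  show "chi_iCFc G \<le> 3"
    unfolding chi_iCFc_def by (rule Least_le) (use outerplanar_iUMc[OF assms] iUMc_imp_iCFc in blast)
  show "chi_iUMo G \<le> 4" if "no_isolated_vertices G"
    unfolding chi_iUMo_def by (rule Least_le) (rule outerplanar_iUMo[OF assms that])
  show "chi_iCFo G \<le> 4" if "no_isolated_vertices G"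
    unfolding chi_iCFo_def by (rule Least_le) (use outerplanar_iUMo[OF assms that] iUMo_imp_iCFo in blast)
qed

lemma class_max_bounds:
  assumes "\<And>G. G \<in> \<C> \<Longrightarrow> f G \<le> u" "H \<in> \<C>" "l \<le> f H"
  shows "class_max_exists f \<C>" "l \<le> class_max f \<C>" "class_max f \<C> \<le> u"
proof -
  have fin: "finite {f G | G. G \<in> \<C>}"
    by (rule finite_subset[of _ "{..u}"]) (use assms(1) in auto)
  have ne: "f H \<in> {f G | G. G \<in> \<C>}" using assms(2) by blast
  show "class_max_exists f \<C>" using fin ne by (auto simp: class_max_exists_def)
  show "l \<le> class_max f \<C>" unfolding class_max_def using Max_ge[OF fin ne] assms(3) by simp
  show "class_max f \<C> \<le> u" unfolding class_max_def
    using fin ne assms(1) by (intro Max.boundedI) auto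
qed


lemma infinite_inj: obtains h :: "nat \<Rightarrow> 'a::infinite" where "inj h"
  using infinite_countable_subset[OF infinite_UNIV] by blast

context convex_graph begin

lemma no_isolated:
  assumes "\<And>i. i < n \<Longrightarrow> nb i \<noteq> {}"
  shows "no_isolated_vertices G"
  unfolding no_isolated_vertices_def
proof
  fix v assume "v \<in> pverts G"
  then obtain i where "i < n" "v = h i" by (auto simp: graph_on_def)
  then show "open_nbhd G v \<noteq> {}" using assms by (simp add: open_nbhd_h)
qed

lemma vertex: "i < n \<Longrightarrow> h i \<in> pverts G"
  by (simp add: graph_on_def)

lemma coloring_range: "coloring_with G k c \<Longrightarrow> i < n \<Longrightarrow> c (h i) \<in> {1..k}"
  using vertex unfolding coloring_with_def by blast

lemma iCFo_at: "iCFo_coloring G k c \<Longrightarrow> i < n \<Longrightarrow> has_unique_color (c \<circ> h) (nb i)"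
  using vertex[of i] unfolding iCFo_coloring_def has_unique_color_image[OF inj, symmetric]
    open_nbhd_h[symmetric] by blast

lemma iCFc_at: "iCFc_coloring G k c \<Longrightarrow> i < n \<Longrightarrow> has_unique_color (c \<circ> h) (insert i (nb i))"
  using vertex[of i] unfolding iCFc_coloring_def has_unique_color_image[OF inj, symmetric]
    closed_nbhd_h[symmetric] by blast

lemma iUMo_at:
  assumes "iUMo_coloring G k c" "i < n" "nb i \<noteq> {}"
  shows "strict_max_on (c \<circ> h) (nb i)"
proof -
  have "has_unique_max c (h ` nb i)"
    using assms(1) vertex[OF assms(2)] unfolding iUMo_coloring_def open_nbhd_h[symmetric] by blast
  then show ?thesis
    using has_unique_max_iff[of "h ` nb i" c] nb_finite assms(3) strict_max_on_image[OF inj] by simp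
qed

end

section \<open>Graphs that force the lower bounds\<close>

lemma triangle_not_iCFo:
  fixes h :: "nat \<Rightarrow> 'a"
  assumes "inj h"
  defines "F \<equiv> {(0, 1), (0, 2), (1, 2)}"
  shows "graph_on h 3 F \<in> outerplanar_graphs" "no_isolated_vertices (graph_on h 3 F)"
    "2 < chi_iCFo (graph_on h 3 F)"
proof -
  interpret convex_graph h 3 F
    using assms(1) by unfold_locales (auto simp: F_def noncrossing_def)
  have nb: "nb 0 = {1, 2}" "nb 1 = {0, 2}" "nb 2 = {0, 1}" unfolding nb_def unfolding F_def by auto
  have lt3: "i = 0 \<or> i = 1 \<or> i = 2" if "i < 3" for i :: nat using that by auto
  show "G \<in> outerplanar_graphs" by (rule outerplanar_graphs)
  show ni: "no_isolated_vertices G" using lt3 nb by (intro no_isolated) fastforce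
  have "\<not> iCFo_coloring G 2 c" for c
  proof
    assume c: "iCFo_coloring G 2 c"
    define d where "d = c \<circ> h"
    have "d i \<in> {1, 2}" if "i < 3" for i
      using c coloring_range[of 2 c i] that by (auto simp: iCFo_coloring_def d_def)
    then have r: "d 0 \<in> {1, 2}" "d 1 \<in> {1, 2}" "d 2 \<in> {1, 2}" by simp_all
    note at = iCFo_at[OF c, folded d_def]
    have "d 1 \<noteq> d 2" "d 0 \<noteq> d 2" "d 0 \<noteq> d 1"
      using at[of 0] at[of 1] at[of 2] unfolding nb has_unique_color_iff by auto
    then show False using r by auto
  qed
  then show "2 < chi_iCFo G" using less_chi(2)[OF pair_graph ni] by blast
qed

text \<open>The bull: a triangle 1, 3, 4 with pendant vertices 0 at 4 and 2 at 3. With two colors,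
  the pendants force a difference inside the closed neighborhoods of 3 and 4, so the other two
  vertices there must agree. This makes the triangle monochromatic, against vertex 1.\<close>

lemma five_vertices_not_iCFc:
  fixes h :: "nat \<Rightarrow> 'a"
  assumes "inj h"
  defines "F \<equiv> {(0, 4), (1, 3), (1, 4), (2, 3), (3, 4)}"
  shows "graph_on h 5 F \<in> outerplanar_graphs" "2 < chi_iCFc (graph_on h 5 F)"
proof -
  interpret convex_graph h 5 F
    using assms(1) by unfold_locales (auto simp: F_def noncrossing_def)
  have nb: "insert 0 (nb 0) = {0, 4}" "insert 1 (nb 1) = {1, 3, 4}" "insert 2 (nb 2) = {2, 3}"
    "insert 3 (nb 3) = {1, 2, 3, 4}" "insert 4 (nb 4) = {0, 1, 3, 4}"
    unfolding nb_def unfolding F_def by auto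
  show "G \<in> outerplanar_graphs" by (rule outerplanar_graphs)
  have "\<not> iCFc_coloring G 2 c" for c
  proof
    assume c: "iCFc_coloring G 2 c"
    define d where "d = c \<circ> h"
    have "d i = 1 \<or> d i = 2" if "i < 5" for i
      using c coloring_range[of 2 c i] that by (auto simp: iCFc_coloring_def d_def)
    then have r: "d 0 = 1 \<or> d 0 = 2" "d 1 = 1 \<or> d 1 = 2" "d 2 = 1 \<or> d 2 = 2" "d 3 = 1 \<or> d 3 = 2" "d 4 = 1 \<or> d 4 = 2"
      by simp_all
    note at = iCFc_at[OF c, folded d_def]
    have "d 0 \<noteq> d 4" using at[of 0] unfolding nb has_unique_color_iff by auto
    moreover have "d 2 \<noteq> d 3" using at[of 2] unfolding nb has_unique_color_iff by auto
    \<comment> \<open>Two colors on four vertices leave one color unique only in a three-to-one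
      split; as 2 and 3 differ, 1 and 4 must agree.\<close>
    moreover have "d 1 = d 4" using at[of 3] r \<open>d 2 \<noteq> d 3\<close> unfolding nb has_unique_color_iff by auto
    moreover have "d 1 = d 3" using at[of 4] r \<open>d 0 \<noteq> d 4\<close> unfolding nb has_unique_color_iff by auto
    ultimately show False using at[of 1] unfolding nb has_unique_color_iff by auto
  qed
  then show "2 < chi_iCFc G" using less_chi(1)[OF pair_graph] by blast
qed

text \<open>Two mirror copies of a gadget share the hub 5. The vertices 0, 2, 4 of degree two force
  1, 3, 5 to have different colors, and 6, 8, 10 do the same for 7, 9, 5. With three colors, the
  maximum around 5 is thereby forced to occur on both sides.\<close>

lemma eleven_vertices_not_iUMo:
  fixes h :: "nat \<Rightarrow> 'a"
  assumes "inj h"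
  defines "F \<equiv> {(0, 1), (0, 5), (1, 2), (1, 5), (2, 3), (3, 4), (3, 5), (4, 5), (5, 6), (5, 7), (5, 9), (5, 10),
    (6, 7), (7, 8), (8, 9), (9, 10)}"
  shows "graph_on h 11 F \<in> outerplanar_graphs" "no_isolated_vertices (graph_on h 11 F)"
    "3 < chi_iUMo (graph_on h 11 F)"
proof -
  interpret convex_graph h 11 F
    using assms(1) by unfold_locales (auto simp: F_def noncrossing_def)
  have nb: "nb 0 = {1, 5}" "nb 1 = {0, 2, 5}" "nb 2 = {1, 3}" "nb 3 = {2, 4, 5}" "nb 4 = {3, 5}"
    "nb 5 = {0, 1, 3, 4, 6, 7, 9, 10}" "nb 6 = {5, 7}" "nb 7 = {5, 6, 8}" "nb 8 = {7, 9}"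
    "nb 9 = {5, 8, 10}" "nb 10 = {5, 9}"
    unfolding nb_def unfolding F_def by auto
  show "G \<in> outerplanar_graphs" by (rule outerplanar_graphs)
  have ne: "nb i \<noteq> {}" if "i < 11" for i
  proof -
    have "i = 0 \<or> i = 1 \<or> i = 2 \<or> i = 3 \<or> i = 4 \<or> i = 5 \<or> i = 6 \<or> i = 7 \<or> i = 8 \<or> i = 9 \<or> i = 10"
      using that by presburger
    then show ?thesis using nb by (elim disjE) simp_all
  qed
  show ni: "no_isolated_vertices G" using ne by (rule no_isolated)
  have "\<not> iUMo_coloring G 3 c" for c
  proof
    assume c: "iUMo_coloring G 3 c"
    define d where "d = c \<circ> h"
    have r: "1 \<le> d i" "d i \<le> 3" if "i < 11" for i
      using c coloring_range[of 3 c i] that by (auto simp: iUMo_coloring_def d_def)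
    have at: "strict_max_on d (nb i)" if "i < 11" for i
      using iUMo_at[OF c that ne[OF that]] by (simp add: d_def)
    have pair: "d a \<noteq> d b" if "nb i = {a, b}" "a \<noteq> b" "i < 11" for i a b
      using at[OF that(3)] that(2) unfolding that(1) strict_max_on_def
      by (auto simp: insert_Diff_if split: if_splits)
    have n: "d 1 \<noteq> d 5" "d 1 \<noteq> d 3" "d 3 \<noteq> d 5" "d 7 \<noteq> d 5" "d 7 \<noteq> d 9" "d 9 \<noteq> d 5"
      using pair[OF nb(1)] pair[OF nb(3)] pair[OF nb(5)] pair[OF nb(7)] pair[OF nb(9)] pair[OF nb(11)]
      by auto
    obtain m where m: "m \<in> nb 5" "\<And>z. z \<in> nb 5 \<Longrightarrow> z \<noteq> m \<Longrightarrow> d z < d m"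
      using at[of 5] unfolding strict_max_on_def by auto
    have only: "u = v" if "u \<in> nb 5" "v \<in> nb 5" "d u = k" "d v = k" "\<And>z. z \<in> nb 5 \<Longrightarrow> d z \<le> k" for u v k
    proof -
      have "d m = k" using m(2)[OF that(1)] that(3) that(5)[OF m(1)] by (metis le_less less_le_not_le)
      then show ?thesis using m(2)[OF that(1)] m(2)[OF that(2)] that(3,4) by auto
    qed
    have clash: False
      if k: "d 1 = k \<or> d 3 = k" "d 7 = k \<or> d 9 = k" "\<And>z. z \<in> nb 5 \<Longrightarrow> d z \<le> k" for k
    proof -
      have mem: "1 \<in> nb 5" "3 \<in> nb 5" "7 \<in> nb 5" "9 \<in> nb 5" unfolding nb by simp_all
      have "\<not> (d u = k \<and> d v = k)" if "u \<in> nb 5" "v \<in> nb 5" "u \<noteq> v" for u v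
        using only[OF that(1,2) _ _ k(3)] that(3) by blast
      from this[OF mem(1,3)] this[OF mem(1,4)] this[OF mem(2,3)] this[OF mem(2,4)]
      show False using k(1,2) by auto
    qed
    have le3: "d z \<le> 3" if "z \<in> nb 5" for z using that r(2)[of z] unfolding nb by auto
    have r5: "1 \<le> d 1" "d 1 \<le> 3" "1 \<le> d 3" "d 3 \<le> 3" "1 \<le> d 5" "d 5 \<le> 3" "1 \<le> d 7" "d 7 \<le> 3" "1 \<le> d 9" "d 9 \<le> 3"
      using r by simp_all
    \<comment> \<open>Otherwise color 3 occurs on each side among the neighbors of 5.\<close>
    have d5: "d 5 = 3"
    proof (rule ccontr)
      assume "d 5 \<noteq> 3"
      then have "d 1 = 3 \<or> d 3 = 3" "d 7 = 3 \<or> d 9 = 3" using n r5 by linarith+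
      then show False using clash[of 3] le3 by blast
    qed
    \<comment> \<open>Vertex \<open>i\<close> sees the highest color at 5, so its other neighbors
      stay below. The four orders only match the ways in which the neighborhoods are
      written.\<close>
    have low: "d a < 3" if l: "nb i = {a, b, 5} \<or> nb i = {b, a, 5} \<or> nb i = {5, a, b} \<or> nb i = {5, b, a}" 
        "a \<noteq> 5" "i < 11" "a < 11" for i a b
    proof -
      obtain y where y: "y \<in> nb i" "\<And>z. z \<in> nb i \<Longrightarrow> z \<noteq> y \<Longrightarrow> d z < d y"
        using at[OF l(3)] unfolding strict_max_on_def by auto
      have mem: "a \<in> nb i" "5 \<in> nb i" using l(1) by auto
      have "y < 11" using y(1) F_less unfolding nb_def by (force simp: F_def)
      then have "y = 5" using y(2)[OF mem(2)] d5 r(2)[of y] by force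
      then show ?thesis using y(2)[OF mem(1)] l(2) d5 by simp
    qed
    have lows: "d 0 < 3" "d 4 < 3" "d 6 < 3" "d 10 < 3"
      using low[of 1 0 2] low[of 3 4 2] low[of 7 6 8] low[of 9 10 8] nb by auto
    have two: "d 1 = 2 \<or> d 3 = 2" "d 7 = 2 \<or> d 9 = 2" and le2: "d 1 \<le> 2" "d 3 \<le> 2" "d 7 \<le> 2" "d 9 \<le> 2"
      using n r5 d5 by linarith+
    have "d z \<le> 2" if "z \<in> nb 5" for z using that lows le2 unfolding nb by auto
    then show False using clash[of 2] two by blast
  qed
  then show "3 < chi_iUMo G" using less_chi(3)[OF pair_graph ni] by blast
qed

theorem theorem1p2:
  shows "let \<O> = (outerplanar_graphs :: 'a::infinite pair_pre_digraph set);
             \<O>' = {G \<in> \<O>. no_isolated_vertices G}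
         in (class_max_exists chi_iCFo \<O>' \<and> 3 \<le> class_max chi_iCFo \<O>' \<and> class_max chi_iCFo \<O>' \<le> 4) \<and>
            (class_max_exists chi_iCFc \<O> \<and> class_max chi_iCFc \<O> = 3) \<and>
            (class_max_exists chi_iUMo \<O>' \<and> 4 \<le> class_max chi_iUMo \<O>' \<and> class_max chi_iUMo \<O>' \<le> 5) \<and>
            (class_max_exists chi_iUMc \<O> \<and> 3 \<le> class_max chi_iUMc \<O> \<and> class_max chi_iUMc \<O> \<le> 5)"
proof -
  let ?O = "outerplanar_graphs :: 'a pair_pre_digraph set"
  let ?O' = "{G \<in> ?O. no_isolated_vertices G}"
  obtain h :: "nat \<Rightarrow> 'a" where h: "inj h" by (rule infinite_inj)
  obtain T where T: "T \<in> ?O" "no_isolated_vertices T" "2 < chi_iCFo T"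
    by (rule that[OF triangle_not_iCFo[OF h]])
  obtain P where P: "P \<in> ?O" "2 < chi_iCFc P"
    by (rule that[OF five_vertices_not_iCFc[OF h]])
  obtain W where W: "W \<in> ?O" "no_isolated_vertices W" "3 < chi_iUMo W"
    by (rule that[OF eleven_vertices_not_iUMo[OF h]])
  have TW: "T \<in> ?O'" "W \<in> ?O'" using T W by simp_all
  have le4: "chi_iCFo G \<le> 4" "chi_iUMo G \<le> 4" if "G \<in> ?O'" for G
    using that outerplanar_chi_le(3,4) by blast+
  have l: "3 \<le> chi_iCFo T" "3 \<le> chi_iCFc P" "4 \<le> chi_iUMo W" using T(3) P(2) W(3) by simp_all
  have l': "3 \<le> chi_iUMc P"
    using chi_iCFc_le_chi_iUMc[of P] P(1) l(2) by (simp add: outerplanar_graphs_def)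
  note a = class_max_bounds[of ?O' chi_iCFo, OF le4(1) TW(1) l(1)]
    and b = class_max_bounds[of ?O chi_iCFc, OF outerplanar_chi_le(1) P(1) l(2)]
    and c = class_max_bounds[of ?O' chi_iUMo, OF le4(2) TW(2) l(3)]
    and d = class_max_bounds[of ?O chi_iUMc, OF outerplanar_chi_le(2) P(1) l']
  show ?thesis
    unfolding Let_def
    using a b(1) antisym[OF b(3,2)] c(1,2) le_trans[OF c(3), of 5] d(1,2) le_trans[OF d(3), of 5] by simp
qed

end
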